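(* Let $H$ be a factorial standard subspace of a complex Hilbert space $\mathcal H$, with modular operator $\Delta=\Delta_H$, modular conjugation $J=J_H$ and cutting projection $P_H$. For $\lambda\in(0,+\infty)\setminus\{1\}$ set $$a(\lambda)=\lambda^{-1/2}(\lambda^{-1/2}-\lambda^{1/2})^{-1},\qquad b(\lambda)=(\lambda^{-1/2}-\lambda^{1/2})^{-1},$$ and let $\mathcal D=\mathrm{Dom}(a(\Delta))\cap\mathrm{Dom}(b(\Delta))$. Then $\mathcal D\subset H+H'$ and $$P_H\big|_{\mathcal D}=\Delta^{-1/2}(\Delta^{-1/2}-\Delta^{1/2})^{-1}+J(\Delta^{-1/2}-\Delta^{1/2})^{-1}=a(\Delta)+Jb(\Delta).$$ Moreover $\mathcal D$ is a core for $P_H$, that is, $P_H=\big(a(\Delta)+Jb(\Delta)\big)^{-}$ (closure). Indeed, already $\mathcal D_0=\bigcup_{0<\varepsilon<1/2}E_\varepsilon\mathcal H$ is a core for $P_H$, where $E_\varepsilon$ is the spectral projection of $\Delta$ relative to the set $(\varepsilon,1-\varepsilon)\cup((1-\varepsilon)^{-1},\varepsilon^{-1})$.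
   Context: A closed real linear subspace $H$ of $\mathcal H$ is standard if $\overline{H+iH}=\mathcal H$ and $H\cap iH=\{0\}$. For $H$ standard, the antilinear operator $S:H+iH\to H+iH$, $S(h_1+ih_2)=h_1-ih_2$, is closed and densely defined; its polar decomposition is $S=J_H\Delta_H^{1/2}$, with $\Delta_H$ positive, non-singular and selfadjoint (modular operator) and $J_H$ an antiunitary involution (modular conjugation). The symplectic complement is $H'=\{k\in\mathcal H:\Im(k,h)=0\ \forall h\in H\}$. $H$ is factorial if $H\cap H'=\{0\}$ (equivalently $\overline{H+H'}=\mathcal H$; equivalently $1$ is not an eigenvalue of $\Delta_H$). For $H$ factorial, the cutting projection $P_H$ is the real linear operator with domain $H+H'$ given by $P_H(h+h')=h$ for $h\in H$, $h'\in H'$. A core for $P_H$ is meant with respect to real linear closed operators (graph closure). *)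

theory Defs
  imports "HOL-Analysis.Analysis"
begin

section \<open>Complex Hilbert spaces\<close>

text \<open>
  A complex Hilbert space carries its underlying real Hilbert space structure, with
  real inner product the real part of the complex one. Norm, topology, completeness and real
  linear subspaces (\<open>subspace\<close>) are those of the library. The inner product is linear in the second
  variable.
\<close>

class chilbert_space = real_inner + complete_space +
  fixes scaleC :: "complex \<Rightarrow> 'a \<Rightarrow> 'a" (infixr \<open>*\<^sub>C\<close> 75)
    and cinner :: "'a \<Rightarrow> 'a \<Rightarrow> complex"
  assumes scaleC_add_right: "c *\<^sub>C (x + y) = c *\<^sub>C x + c *\<^sub>C y"
    and scaleC_add_left: "(c + d) *\<^sub>C x = c *\<^sub>C x + d *\<^sub>C x"
    and scaleC_scaleC: "c *\<^sub>C d *\<^sub>C x = (c * d) *\<^sub>C x"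
    and scaleC_one: "1 *\<^sub>C x = x"
    and scaleR_scaleC: "r *\<^sub>R x = complex_of_real r *\<^sub>C x"
    and cinner_commute: "cinner x y = cnj (cinner y x)"
    and cinner_add_right: "cinner x (y + z) = cinner x y + cinner x z"
    and cinner_scaleC_right: "cinner x (c *\<^sub>C y) = c * cinner x y"
    and inner_eq_Re_cinner: "inner x y = Re (cinner x y)"


section \<open>Unbounded operators as graphs\<close>

text \<open>
  A not everywhere defined operator is identified with its graph, so that the closure of an
  operator is the topological \<^const>\<open>closure\<close> of its graph, its domain is \<^const>\<open>Domain\<close>, and its inverse
  is \<^const>\<open>converse\<close>. Equality of operators includes equality of domains.
\<close>

type_synonym 'a graph = "('a \<times> 'a) set"

definition op_comp :: "'a graph \<Rightarrow> 'a graph \<Rightarrow> 'a graph"  (infixr \<open>\<odot>\<close> 75)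
  where "A \<odot> B = B O A"

definition op_plus :: "'a::plus graph \<Rightarrow> 'a graph \<Rightarrow> 'a graph"  (infixl \<open>\<boxplus>\<close> 65)
  where "A \<boxplus> B = {(x, y + z) | x y z. (x, y) \<in> A \<and> (x, z) \<in> B}"

definition op_minus :: "'a::minus graph \<Rightarrow> 'a graph \<Rightarrow> 'a graph"  (infixl \<open>\<boxminus>\<close> 65)
  where "A \<boxminus> B = {(x, y - z) | x y z. (x, y) \<in> A \<and> (x, z) \<in> B}"

definition graph_of :: "('a \<Rightarrow> 'a) \<Rightarrow> 'a graph"
  where "graph_of f = {(x, f x) | x. True}"

definition op_restrict :: "'a graph \<Rightarrow> 'a set \<Rightarrow> 'a graph"
  where "op_restrict A D = {(x, y) \<in> A. x \<in> D}"

definition adjoint_op :: "'a::chilbert_space graph \<Rightarrow> 'a graph"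
  where "adjoint_op A = {(y, z). \<forall>(x, w) \<in> A. cinner y w = cinner z x}"

text \<open>An adjoint is a closed complex linear relation, and it is single-valued when the domain is
  dense; so linearity and single-valuedness need not be required separately here.\<close>

definition selfadjoint :: "'a::chilbert_space graph \<Rightarrow> bool"
  where "selfadjoint A \<longleftrightarrow> closure (Domain A) = UNIV \<and> adjoint_op A = A"

definition positive_op :: "'a::chilbert_space graph \<Rightarrow> bool"
  where "positive_op A \<longleftrightarrow> (\<forall>(x, y) \<in> A. Im (cinner x y) = 0 \<and> Re (cinner x y) \<ge> 0)"

definition nonsingular :: "'a::zero graph \<Rightarrow> bool"
  where "nonsingular A \<longleftrightarrow> (\<forall>x. (x, 0) \<in> A \<longrightarrow> x = 0)"

definition antiunitary_involution :: "('a::chilbert_space \<Rightarrow> 'a) \<Rightarrow> bool"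
  where "antiunitary_involution J \<longleftrightarrow>
    (\<forall>x y. J (x + y) = J x + J y) \<and> (\<forall>c x. J (c *\<^sub>C x) = cnj c *\<^sub>C J x) \<and>
    (\<forall>x y. cinner (J x) (J y) = cinner y x) \<and> (\<forall>x. J (J x) = x)"

definition is_core :: "'a::real_normed_vector set \<Rightarrow> 'a graph \<Rightarrow> bool"
  where "is_core D A \<longleftrightarrow> subspace D \<and> D \<subseteq> Domain A \<and> closure (op_restrict A D) = A"


section \<open>Spectral measures and Borel functional calculus\<close>

definition orth_projection :: "('a::chilbert_space \<Rightarrow> 'a) \<Rightarrow> bool"
  where "orth_projection P \<longleftrightarrow>
    (\<forall>x y. P (x + y) = P x + P y) \<and> (\<forall>c x. P (c *\<^sub>C x) = c *\<^sub>C P x) \<and>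
    (\<forall>x. P (P x) = P x) \<and> (\<forall>x y. cinner (P x) y = cinner x (P y))"

definition projection_valued_measure :: "(real set \<Rightarrow> 'a::chilbert_space \<Rightarrow> 'a) \<Rightarrow> bool"
  where "projection_valued_measure E \<longleftrightarrow>
    (\<forall>B \<in> sets borel. orth_projection (E B)) \<and>
    (\<forall>x. E UNIV x = x) \<and>
    (\<forall>B \<in> sets borel. \<forall>C \<in> sets borel. \<forall>x. E (B \<inter> C) x = E B (E C x)) \<and>
    (\<forall>F. range F \<subseteq> sets borel \<and> disjoint_family F \<longrightarrow>
       (\<forall>x. (\<lambda>n. E (F n) x) sums E (\<Union>n. F n) x))"

definition scalar_measure :: "(real set \<Rightarrow> 'a::chilbert_space \<Rightarrow> 'a) \<Rightarrow> 'a \<Rightarrow> real measure"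
  where "scalar_measure E x = measure_of UNIV (sets borel) (\<lambda>B. ennreal (Re (cinner x (E B x))))"

definition simple_integral :: "(real set \<Rightarrow> 'a::chilbert_space \<Rightarrow> 'a) \<Rightarrow> (real \<Rightarrow> real) \<Rightarrow> 'a \<Rightarrow> 'a"
  where "simple_integral E s x = (\<Sum>v \<in> range s. v *\<^sub>R E (s -` {v}) x)"

text \<open>
  The operator \<open>\<integral> f dE\<close> for a real Borel function \<open>f\<close>, on its natural domain
  \<open>{x. \<integral> f\<^sup>2 d\<mu> < \<infinity>}\<close>, where \<open>\<mu>\<close> is the scalar measure \<open>\<langle>x, E(\<cdot>) x\<rangle>\<close>. For \<open>x\<close> in this domain,
  \<open>s \<mapsto> (\<integral> s dE) x\<close> is isometric on simple functions for the norm of \<open>L\<^sup>2(\<mu>)\<close>, and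
  \<open>(\<integral> f dE) x\<close> is its continuous extension evaluated at \<open>f\<close>.
\<close>

definition spectral_integral :: "(real set \<Rightarrow> 'a::chilbert_space \<Rightarrow> 'a) \<Rightarrow> (real \<Rightarrow> real) \<Rightarrow> 'a graph"
  where "spectral_integral E f = {(x, y).
    (\<integral>\<^sup>+ t. ennreal ((f t)\<^sup>2) \<partial>scalar_measure E x) < \<infinity> \<and>
    (\<exists>s. (\<forall>n::nat. simple_function borel (s n)) \<and>
         (\<lambda>n. \<integral>\<^sup>+ t. ennreal ((f t - s n t)\<^sup>2) \<partial>scalar_measure E x) \<longlonglongrightarrow> 0 \<and>
         (\<lambda>n. simple_integral E (s n) x) \<longlonglongrightarrow> y)}"

definition spectral_measure_of :: "(real set \<Rightarrow> 'a::chilbert_space \<Rightarrow> 'a) \<Rightarrow> 'a graph \<Rightarrow> bool"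
  where "spectral_measure_of E A \<longleftrightarrow> projection_valued_measure E \<and> A = spectral_integral E (\<lambda>t. t)"


section \<open>Standard subspaces\<close>

definition standard_subspace :: "'a::chilbert_space set \<Rightarrow> bool"
  where "standard_subspace H \<longleftrightarrow> subspace H \<and> closed H \<and>
    closure {h + \<i> *\<^sub>C k | h k. h \<in> H \<and> k \<in> H} = UNIV \<and> H \<inter> (\<lambda>h. \<i> *\<^sub>C h) ` H = {0}"

definition symplectic_complement :: "'a::chilbert_space set \<Rightarrow> 'a set"
  where "symplectic_complement H = {k. \<forall>h \<in> H. Im (cinner k h) = 0}"

definition factorial_subspace :: "'a::chilbert_space set \<Rightarrow> bool"
  where "factorial_subspace H \<longleftrightarrow> H \<inter> symplectic_complement H = {0}"

definition tomita_op :: "'a::chilbert_space set \<Rightarrow> 'a graph"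
  where "tomita_op H = {(h + \<i> *\<^sub>C k, h - \<i> *\<^sub>C k) | h k. h \<in> H \<and> k \<in> H}"

text \<open>
  \<open>S = J \<Delta>\<^sup>1\<^sup>/\<^sup>2\<close> is the polar decomposition of the Tomita operator \<open>S\<close>, where \<open>E\<close> is the spectral
  measure of \<open>\<Delta>\<close>. By uniqueness of polar decompositions and of spectral measures,
  \<open>\<Delta>\<close>, \<open>J\<close> and \<open>E\<close> (on Borel sets) are determined by \<open>H\<close>.
\<close>

definition modular_objects ::
    "'a::chilbert_space set \<Rightarrow> 'a graph \<Rightarrow> ('a \<Rightarrow> 'a) \<Rightarrow> (real set \<Rightarrow> 'a \<Rightarrow> 'a) \<Rightarrow> bool"
  where "modular_objects H \<Delta> J E \<longleftrightarrow>
    selfadjoint \<Delta> \<and> positive_op \<Delta> \<and> nonsingular \<Delta> \<and> antiunitary_involution J \<and>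
    spectral_measure_of E \<Delta> \<and>
    tomita_op H = graph_of J \<odot> spectral_integral E (\<lambda>t. t powr (1/2))"

definition cutting_projection :: "'a::chilbert_space set \<Rightarrow> 'a graph"
  where "cutting_projection H = {(h + h', h) | h h'. h \<in> H \<and> h' \<in> symplectic_complement H}"

text \<open>
  Only the values on \<open>(0, \<infinity>) - {1}\<close> matter: the complement is a null set for the spectral measure
  of the modular operator of a factorial standard subspace.
\<close>

definition a_fun :: "real \<Rightarrow> real"
  where "a_fun t = t powr (-1/2) * inverse (t powr (-1/2) - t powr (1/2))"

definition b_fun :: "real \<Rightarrow> real"
  where "b_fun t = inverse (t powr (-1/2) - t powr (1/2))"

end

(*
  Put T = Delta^(1/2). Since the Tomita operator S = J T equals its inverse, J T J = T^(-1). Hence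
  every pair (u, c) in the graph of T yields u + J c in H and c + J u in the symplectic complement
  of H. Applied to (a(Delta) x, b(Delta) x) and (b(Delta) x, a(Delta) x - x) this splits
  every x in D as prescribed by a(Delta) + J b(Delta); applied to (x, x) with x fixed by E {1}, it
  shows that factoriality excludes the eigenvalue 1.

  For the core property it suffices that the spectral projections of the windows, which increase
  to the identity, preserve H and its symplectic complement, that is, commute with J. As the
  windows are invariant under t -> 1/t, this follows from J E (0, c] = E [1/c, infinity) J. The
  latter is proved without appeal to the uniqueness of spectral measures: if d c < 1, then for x in
  the range of E (0, c] the relation J T J = T^(-1) gives
  |E (0, d] J x|^2 <= d |E (0, d] J T x|^2, and iterating yields the bound (d c)^n |x|^2 -> 0.
*)

theory Submission
  imports Defs
begin

section \<open>Complex scalars and graphs\<close>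

text \<open>The two functions are forced. Asking that (a x, b x) and (b x, a x - x) both lie in the
  graph of T means b = t^(1/2) a and a - 1 = t^(1/2) b, whose only solution off 1 is a = 1/(1 - t),
  b = t^(1/2)/(1 - t). The main burden is domains. Operators are graphs, equality includes equality
  of domains, and the approximating sequence in \<open>spectral_integral\<close> may vary with the
  vector. The calculus is therefore developed on single pairs (x, y): once y is the value at x, the
  product rule is an equivalence and no closure enters. Linearity in x is not immediate either,
  because the scalar measure is quadratic in x. Identities between the functions are used on (0,
  infinity) - {1}. This set carries every vector: positivity together with nonsingularity removes
  the negative axis, nonsingularity removes 0, and factoriality removes 1. The cutting projection is
  closed even when H + H' is not, because its graph is given by the closed conditions y in H and x -
  y in H'. A core statement thus reduces to approximating each pair (x, h) of the graph inside the
  restricted graph.\<close>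

lemma scaleC_minus_right: "c *\<^sub>C (- x) = - (c *\<^sub>C (x::'a::chilbert_space))"
  using scaleR_scaleC[of "-1" x] scaleR_scaleC[of "-1" "c *\<^sub>C x"] by (simp add: scaleC_scaleC)

lemma cinner_scaleC_left: "cinner (c *\<^sub>C x) y = cnj c * cinner x (y::'a::chilbert_space)"
  by (metis cinner_commute cinner_scaleC_right complex_cnj_mult)

text \<open>Turns the symplectic form into a real inner product: the symplectic complement of H
  becomes the real orthogonal complement of i H.\<close>

lemma Im_cinner: "Im (cinner x y) = inner (\<i> *\<^sub>C x) (y::'a::chilbert_space)"
  by (simp add: inner_eq_Re_cinner cinner_scaleC_left)

lemma norm_scaleC: "norm (c *\<^sub>C x) = cmod c * norm (x::'a::chilbert_space)"
proof -
  have "inner (c *\<^sub>C x) (c *\<^sub>C x) = Re (cnj c * c * cinner x x)"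
    by (simp only: inner_eq_Re_cinner cinner_scaleC_left cinner_scaleC_right mult.assoc mult.left_commute)
  also have "cnj c * c = complex_of_real ((cmod c)\<^sup>2)"
    by (metis complex_norm_square mult.commute)
  finally have "(norm (c *\<^sub>C x))\<^sup>2 = (cmod c * norm x)\<^sup>2"
    by (simp add: power2_norm_eq_inner inner_eq_Re_cinner power_mult_distrib)
  then show ?thesis by simp
qed

lemma bounded_linear_scaleC: "bounded_linear (\<lambda>x::'a::chilbert_space. c *\<^sub>C x)"
proof (rule bounded_linear_intro[where K = "cmod c"])
  show "c *\<^sub>C (r *\<^sub>R x) = r *\<^sub>R (c *\<^sub>C (x::'a))" for r x by (simp add: scaleR_scaleC scaleC_scaleC mult.commute)
  show "norm (c *\<^sub>C x) \<le> norm x * cmod c" for x :: 'a by (simp add: norm_scaleC)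
qed (rule scaleC_add_right)

lemma op_comp_iff: "(x, z) \<in> A \<odot> B \<longleftrightarrow> (\<exists>y. (x, y) \<in> B \<and> (y, z) \<in> A)"
  by (auto simp: op_comp_def)

lemma graph_of_iff: "(x, y) \<in> graph_of f \<longleftrightarrow> y = f x"
  by (auto simp: graph_of_def)

section \<open>Spectral integrals\<close>

locale pvm =
  fixes E :: "real set \<Rightarrow> 'a::chilbert_space \<Rightarrow> 'a"
  assumes pvm: "projection_valued_measure E"
begin

section \<open>Algebra of a projection-valued measure\<close>

lemma proj: "B \<in> sets borel \<Longrightarrow> orth_projection (E B)"
  using pvm by (simp add: projection_valued_measure_def)

lemma E_add: "B \<in> sets borel \<Longrightarrow> E B (x + y) = E B x + E B y"
  using proj by (simp add: orth_projection_def)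

lemma E_scaleC: "B \<in> sets borel \<Longrightarrow> E B (c *\<^sub>C x) = c *\<^sub>C E B x"
  using proj by (simp add: orth_projection_def)

lemma E_scaleR: "B \<in> sets borel \<Longrightarrow> E B (c *\<^sub>R x) = c *\<^sub>R E B x"
  by (simp add: scaleR_scaleC E_scaleC)

lemma E_inner: "B \<in> sets borel \<Longrightarrow> inner (E B x) y = inner x (E B y)"
  using proj by (simp add: orth_projection_def inner_eq_Re_cinner)

lemma E_UNIV: "E UNIV x = x"
  using pvm by (simp add: projection_valued_measure_def)

lemma E_Int: "B \<in> sets borel \<Longrightarrow> C \<in> sets borel \<Longrightarrow> E (B \<inter> C) x = E B (E C x)"
  using pvm by (simp add: projection_valued_measure_def)

lemma E_idem: "B \<in> sets borel \<Longrightarrow> E B (E B x) = E B x"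
  using E_Int[of B B] by simp

lemma E_sums: "range F \<subseteq> sets borel \<Longrightarrow> disjoint_family F \<Longrightarrow> (\<lambda>n. E (F n) x) sums E (\<Union>n. F n) x"
  using pvm by (simp add: projection_valued_measure_def)

lemma inner_E: "B \<in> sets borel \<Longrightarrow> inner x (E B x) = (norm (E B x))\<^sup>2"
  by (metis E_idem E_inner power2_norm_eq_inner)

lemma norm_E_le: assumes "B \<in> sets borel" shows "norm (E B x) \<le> norm x"
proof -
  have "norm (E B x) * norm (E B x) \<le> norm x * norm (E B x)"
    using inner_E[OF assms, of x] norm_cauchy_schwarz[of x "E B x"] by (simp add: power2_eq_square)
  then show ?thesis by (cases "E B x = 0") auto
qed

lemma bounded_linear_E: assumes "B \<in> sets borel" shows "bounded_linear (E B)"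
  by (rule bounded_linear_intro[where K = 1]) (use assms norm_E_le in \<open>auto simp: E_add E_scaleR\<close>)

lemma E_diff: "B \<in> sets borel \<Longrightarrow> E B (x - y) = E B x - E B y"
  by (metis bounded_linear_E bounded_linear.linear linear_diff)

lemma E_zero: "B \<in> sets borel \<Longrightarrow> E B 0 = 0"
  by (metis bounded_linear_E bounded_linear.linear linear_0)

lemma E_sum: "B \<in> sets borel \<Longrightarrow> E B (sum f S) = (\<Sum>i\<in>S. E B (f i))"
  by (metis bounded_linear_E bounded_linear.linear linear_sum)

text \<open>Countable additivity for the constant family of empty sets makes a constant series
  converge, so its term vanishes.\<close>

lemma E_empty: "E {} x = 0"
proof -
  have "(\<lambda>n::nat. E {} x) sums E {} x"
    using E_sums[of "\<lambda>n. {}" x] by (simp add: disjoint_family_on_def)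
  then have "summable (\<lambda>n::nat. E {} x)" by (rule sums_summable)
  then have "(\<lambda>n::nat. E {} x) \<longlonglongrightarrow> 0" by (rule summable_LIMSEQ_zero)
  then show ?thesis by (simp add: LIMSEQ_const_iff)
qed

lemma E_Un: assumes "A \<in> sets borel" "B \<in> sets borel" "A \<inter> B = {}"
  shows "E (A \<union> B) x = E A x + E B x"
proof -
  have "disjoint_family (binaryset A B)"
    using assms by (auto simp: disjoint_family_on_def binaryset_def)
  moreover have "range (binaryset A B) \<subseteq> sets borel"
    using assms by (simp add: range_binaryset_eq)
  ultimately have "(\<lambda>n. E (binaryset A B n) x) sums E (A \<union> B) x"
    using E_sums[of "binaryset A B" x] by (simp add: UN_binaryset_eq)
  moreover have "(\<lambda>n. E (binaryset A B n) x) sums (E A x + E B x)"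
    by (rule binaryset_sums[where f = "\<lambda>B. E B x"]) (rule E_empty)
  ultimately show ?thesis by (rule sums_unique2)
qed

lemma E_UN: assumes "finite C" "\<And>c. c \<in> C \<Longrightarrow> A c \<in> sets borel" "disjoint_family_on A C"
  shows "E (\<Union>c\<in>C. A c) x = (\<Sum>c\<in>C. E (A c) x)"
  using assms
proof (induction C rule: finite_induct)
  case empty
  then show ?case by (simp add: E_empty)
next
  case (insert c C)
  have "A c \<inter> (\<Union>c\<in>C. A c) = {}"
    using insert.hyps insert.prems by (auto simp: disjoint_family_on_def)
  moreover have "(\<Union>c\<in>C. A c) \<in> sets borel"
    using insert by (intro sets.finite_UN) auto
  ultimately have "E (\<Union>c\<in>insert c C. A c) x = E (A c) x + E (\<Union>c\<in>C. A c) x"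
    using insert.prems by (simp add: E_Un)
  then show ?case using insert by (simp add: disjoint_family_on_def)
qed

section \<open>Scalar measures\<close>

abbreviation \<mu> :: "'a \<Rightarrow> real measure" where "\<mu> x \<equiv> scalar_measure E x"

lemma sets_\<mu> [simp, measurable_cong]: "sets (\<mu> x) = sets borel"
  unfolding scalar_measure_def by (metis sets.sets_measure_of_eq space_borel)

lemma space_\<mu> [simp]: "space (\<mu> x) = UNIV"
  by (metis sets_\<mu> sets_eq_imp_space_eq space_borel)

text \<open>\<open>measure_of\<close> takes the prescribed values only after countable additivity is
  verified; that is \<open>E_sums\<close> seen through the real inner product with
  \<open>x\<close>.\<close>

lemma emeasure_\<mu>: assumes "B \<in> sets borel" shows "emeasure (\<mu> x) B = ennreal ((norm (E B x))\<^sup>2)"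
proof -
  let ?m = "\<lambda>B. ennreal (Re (cinner x (E B x)))"
  have eq: "Re (cinner x (E B x)) = (norm (E B x))\<^sup>2" if "B \<in> sets borel" for B
    using inner_E[OF that] by (simp add: inner_eq_Re_cinner)
  have "countably_additive (sets borel) ?m"
  proof (rule countably_additiveI)
    fix F :: "nat \<Rightarrow> real set"
    assume F: "range F \<subseteq> sets borel" "disjoint_family F" "(\<Union>i. F i) \<in> sets borel"
    have "(\<lambda>n. inner x (E (F n) x)) sums inner x (E (\<Union>n. F n) x)"
      by (rule bounded_linear.sums[OF bounded_linear_inner_right E_sums[OF F(1,2)]])
    then have "(\<lambda>n. Re (cinner x (E (F n) x))) sums Re (cinner x (E (\<Union>n. F n) x))"
      by (simp add: inner_eq_Re_cinner)
    moreover have "0 \<le> Re (cinner x (E (F n) x))" for n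
      using F(1) eq[of "F n"] by (simp add: range_subsetD)
    ultimately show "(\<Sum>i. ?m (F i)) = ?m (\<Union>i. F i)"
      by (intro suminf_ennreal_eq)
  qed
  then have "emeasure (\<mu> x) B = ?m B"
    using assms sets.sigma_algebra_axioms[of borel]
    by (intro emeasure_measure_of[OF scalar_measure_def])
       (auto simp: positive_def E_empty inner_eq_Re_cinner[symmetric])
  then show ?thesis using eq[OF assms] by simp
qed

section \<open>Simple integrals\<close>

text \<open>The type of \<open>p\<close> is left free so that \<open>p\<close> can be the pair of
  two simple functions. Its fibres are then a common refinement, over which sums, differences and
  products are computed termwise.\<close>

lemma simple_integral_partition:
  fixes p :: "real \<Rightarrow> 'b"
  assumes "finite (range p)" "\<And>c. p -` {c} \<in> sets borel"
  shows "simple_integral E (\<lambda>t. \<phi> (p t)) x = (\<Sum>c\<in>range p. \<phi> c *\<^sub>R E (p -` {c}) x)"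
proof -
  have "v *\<^sub>R E ((\<lambda>t. \<phi> (p t)) -` {v}) x = (\<Sum>c\<in>{c \<in> range p. \<phi> c = v}. \<phi> c *\<^sub>R E (p -` {c}) x)" for v
  proof -
    have "(\<lambda>t. \<phi> (p t)) -` {v} = (\<Union>c\<in>{c \<in> range p. \<phi> c = v}. p -` {c})" by auto
    then have "E ((\<lambda>t. \<phi> (p t)) -` {v}) x = (\<Sum>c\<in>{c \<in> range p. \<phi> c = v}. E (p -` {c}) x)"
      using assms by (simp only:) (rule E_UN; auto simp: disjoint_family_on_def)
    then have "v *\<^sub>R E ((\<lambda>t. \<phi> (p t)) -` {v}) x = (\<Sum>c\<in>{c \<in> range p. \<phi> c = v}. v *\<^sub>R E (p -` {c}) x)"
      by (simp add: scaleR_sum_right)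
    also have "\<dots> = (\<Sum>c\<in>{c \<in> range p. \<phi> c = v}. \<phi> c *\<^sub>R E (p -` {c}) x)"
      by (rule sum.cong) auto
    finally show ?thesis .
  qed
  moreover have "finite (range (\<lambda>t. \<phi> (p t)))"
    using finite_imageI[OF assms(1), of \<phi>] by (simp add: image_image)
  ultimately show ?thesis
    unfolding simple_integral_def
    using sum.group[OF assms(1), of "range (\<lambda>t. \<phi> (p t))" \<phi> "\<lambda>c. \<phi> c *\<^sub>R E (p -` {c}) x"]
    by (simp add: image_subset_iff)
qed

lemma simple_function_pair:
  assumes "simple_function borel (s :: real \<Rightarrow> real)" "simple_function borel (r :: real \<Rightarrow> real)"
  shows "finite (range (\<lambda>t. (s t, r t)))" "(\<lambda>t. (s t, r t)) -` {c} \<in> sets borel"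
  using simple_function_Pair[OF assms] simple_functionD[of borel] by fastforce+

lemma simple_add:
  assumes "simple_function borel s" "simple_function borel r"
  shows "simple_integral E (\<lambda>t. s t + r t) x = simple_integral E s x + simple_integral E r x"
  using simple_integral_partition[OF simple_function_pair[OF assms], of "\<lambda>(u,v). u + v" x]
    simple_integral_partition[OF simple_function_pair[OF assms], of fst x]
    simple_integral_partition[OF simple_function_pair[OF assms], of snd x]
  by (simp add: case_prod_beta scaleR_add_left sum.distrib)

lemma simple_diff:
  assumes "simple_function borel s" "simple_function borel r"
  shows "simple_integral E (\<lambda>t. s t - r t) x = simple_integral E s x - simple_integral E r x"
  using simple_integral_partition[OF simple_function_pair[OF assms], of "\<lambda>(u,v). u - v" x]
    simple_integral_partition[OF simple_function_pair[OF assms], of fst x]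
    simple_integral_partition[OF simple_function_pair[OF assms], of snd x]
  by (simp add: case_prod_beta scaleR_diff_left sum_subtractf)

lemma simple_fiber: "simple_function borel (s :: real \<Rightarrow> real) \<Longrightarrow> finite (range s)"
  "simple_function borel (s :: real \<Rightarrow> real) \<Longrightarrow> s -` {v} \<in> sets borel"
  using simple_functionD[of borel s] by fastforce+

lemma bounded_linear_simple:
  assumes "simple_function borel s" shows "bounded_linear (simple_integral E s)"
  unfolding simple_integral_def
  by (intro bounded_linear_sum bounded_linear_const_scaleR bounded_linear_E simple_fiber assms)

lemma simple_inner:
  assumes "simple_function borel s"
  shows "inner (simple_integral E s x) y = inner x (simple_integral E s y)"
  unfolding simple_integral_def
  by (simp add: inner_sum_left inner_sum_right E_inner simple_fiber assms)

lemma simple_mult: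
  assumes "simple_function borel s" "simple_function borel r"
  shows "simple_integral E s (simple_integral E r x) = simple_integral E (\<lambda>t. s t * r t) x"
proof -
  let ?p = "\<lambda>t. (s t, r t)"
  note p = simple_function_pair[OF assms]
  \<comment> \<open>Fibres over distinct pairs are disjoint, so only the diagonal of the double sum
    below survives.\<close>
  have *: "E (?p -` {c}) (E (?p -` {d}) x) = (if c = d then E (?p -` {c}) x else 0)" for c d
  proof (cases "c = d")
    case False
    then have "?p -` {c} \<inter> ?p -` {d} = {}" by auto
    then show ?thesis using False E_Int[OF p(2) p(2), of c d x] by (simp add: E_empty)
  qed (use p in \<open>simp add: E_idem\<close>)
  have "simple_integral E s (simple_integral E r x)
      = (\<Sum>c\<in>range ?p. fst c *\<^sub>R E (?p -` {c}) (\<Sum>d\<in>range ?p. snd d *\<^sub>R E (?p -` {d}) x))"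
    using simple_integral_partition[OF p, of fst] simple_integral_partition[OF p, of snd] by simp
  also have "\<dots> = (\<Sum>c\<in>range ?p. \<Sum>d\<in>range ?p. if c = d then (fst c * snd d) *\<^sub>R E (?p -` {c}) x else 0)"
    using p by (simp add: E_sum E_scaleR * scaleR_sum_right if_distrib cong: if_cong)
  also have "\<dots> = (\<Sum>c\<in>range ?p. (fst c * snd c) *\<^sub>R E (?p -` {c}) x)"
    using p(1) by (simp add: sum.delta)
  also have "\<dots> = simple_integral E (\<lambda>t. s t * r t) x"
    using simple_integral_partition[OF p, of "\<lambda>c. fst c * snd c" x] by simp
  finally show ?thesis .
qed

lemma simple_indicator:
  assumes "B \<in> sets borel" shows "simple_integral E (indicat_real B) x = E B x"
proof -
  have "range (indicat_real B) \<subseteq> {0,1}" by (auto simp: indicator_def)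
  \<comment> \<open>For \<open>B\<close> empty or the whole line the indicator misses one of the
    values 0, 1; the corresponding fibre is empty and adds nothing.\<close>
  moreover have "E (indicat_real B -` {v}) x = 0" if "v \<in> {0,1} - range (indicat_real B)" for v
  proof -
    have "indicat_real B -` {v} = {}" using that by auto
    then show ?thesis by (simp add: E_empty)
  qed
  ultimately have "simple_integral E (indicat_real B) x = (\<Sum>v\<in>{0,1}. v *\<^sub>R E (indicat_real B -` {v}) x)"
    unfolding simple_integral_def by (intro sum.mono_neutral_left) auto
  moreover have "indicat_real B -` {1} = B" by (auto simp: indicator_def)
  ultimately show ?thesis by simp
qed

section \<open>Squared L2 seminorms and approximation by simple functions\<close>

text \<open>The square of the norm, valued in \<open>ennreal\<close>, so that finiteness is
  literally the domain condition of \<open>spectral_integral\<close>.\<close>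

definition L2 :: "'a \<Rightarrow> (real \<Rightarrow> real) \<Rightarrow> ennreal"
  where "L2 x f = (\<integral>\<^sup>+ t. ennreal ((f t)\<^sup>2) \<partial>\<mu> x)"

text \<open>A simple integral is symmetric and multiplicative, so its squared norm at
  \<open>x\<close> is the inner product of \<open>x\<close> with the simple integral of the squared
  function.\<close>

lemma simple_isometry:
  assumes "simple_function borel s"
  shows "ennreal ((norm (simple_integral E s x))\<^sup>2) = L2 x s"
proof -
  note s = simple_fiber[OF assms]
  have "(norm (simple_integral E s x))\<^sup>2 = inner x (simple_integral E (\<lambda>t. s t * s t) x)"
    by (simp add: power2_norm_eq_inner simple_inner simple_mult assms)
  also have "\<dots> = (\<Sum>v\<in>range s. v\<^sup>2 * (norm (E (s -` {v}) x))\<^sup>2)"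
    using simple_integral_partition[OF s, of "\<lambda>v. v * v" x] s
    by (simp add: inner_sum_right inner_E power2_eq_square)
  finally have "ennreal ((norm (simple_integral E s x))\<^sup>2)
      = (\<Sum>v\<in>range s. ennreal (v\<^sup>2) * emeasure (\<mu> x) (s -` {v}))"
    using s by (simp add: emeasure_\<mu> ennreal_mult sum_ennreal[symmetric])
  also have "\<dots> = (\<integral>\<^sup>+ t. (\<Sum>v\<in>range s. ennreal (v\<^sup>2) * indicator (s -` {v}) t) \<partial>\<mu> x)"
    using s by (subst nn_integral_sum) (auto simp: nn_integral_cmult_indicator intro!: borel_measurable_indicator)
  also have "\<dots> = L2 x s"
    unfolding L2_def
  proof (rule nn_integral_cong)
    fix t
    have "(\<Sum>v\<in>range s. ennreal (v\<^sup>2) * indicator (s -` {v}) t)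
        = (\<Sum>v\<in>range s. if v = s t then ennreal ((s t)\<^sup>2) else 0)"
      by (rule sum.cong) (auto simp: indicator_def)
    then show "(\<Sum>v\<in>range s. ennreal (v\<^sup>2) * indicator (s -` {v}) t) = ennreal ((s t)\<^sup>2)"
      using s(1) by (simp add: sum.delta)
  qed
  finally show ?thesis .
qed

text \<open>A crude stand-in for the triangle inequality that avoids square roots in
  \<open>ennreal\<close>; the factor 2 is harmless for finiteness and for convergence to 0.\<close>

lemma L2_le_two:
  assumes [measurable]: "f \<in> borel_measurable borel" "g \<in> borel_measurable borel"
    and "\<And>t. (h t)\<^sup>2 \<le> 2 * (f t)\<^sup>2 + 2 * (g t)\<^sup>2"
  shows "L2 x h \<le> 2 * L2 x f + 2 * L2 x g"
proof -
  have "L2 x h \<le> (\<integral>\<^sup>+ t. 2 * ennreal ((f t)\<^sup>2) + 2 * ennreal ((g t)\<^sup>2) \<partial>\<mu> x)"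
    unfolding L2_def
  proof (rule nn_integral_mono)
    fix t
    have "ennreal ((h t)\<^sup>2) \<le> ennreal (2 * (f t)\<^sup>2 + 2 * (g t)\<^sup>2)"
      using assms(3) by (rule ennreal_leI)
    also have "\<dots> = 2 * ennreal ((f t)\<^sup>2) + 2 * ennreal ((g t)\<^sup>2)"
      by (simp add: ennreal_plus ennreal_mult')
    finally show "ennreal ((h t)\<^sup>2) \<le> 2 * ennreal ((f t)\<^sup>2) + 2 * ennreal ((g t)\<^sup>2)" .
  qed
  also have "\<dots> = 2 * L2 x f + 2 * L2 x g"
    unfolding L2_def by (simp add: nn_integral_add nn_integral_cmult)
  finally show ?thesis .
qed

lemma power2_add_le: "(a + b)\<^sup>2 \<le> 2 * a\<^sup>2 + 2 * (b::real)\<^sup>2"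
  using zero_le_power2[of "a - b"] by (simp add: power2_sum power2_diff)

lemma power2_diff_le: "(a - b)\<^sup>2 \<le> 2 * a\<^sup>2 + 2 * (b::real)\<^sup>2"
  using power2_add_le[of a "- b"] by simp

lemma L2_tendsto_zero:
  assumes [measurable]: "\<And>n. f n \<in> borel_measurable borel" "\<And>n. g n \<in> borel_measurable borel"
    and "\<And>n t. (h n t)\<^sup>2 \<le> 2 * (f n t)\<^sup>2 + 2 * (g n t)\<^sup>2"
    and "(\<lambda>n. L2 x (f n)) \<longlonglongrightarrow> 0" "(\<lambda>n. L2 x (g n)) \<longlonglongrightarrow> 0"
  shows "(\<lambda>n. L2 x (h n)) \<longlonglongrightarrow> 0"
proof (rule tendsto_sandwich[OF _ _ tendsto_const])
  have "(\<lambda>n. 2 * L2 x (f n) + 2 * L2 x (g n)) \<longlonglongrightarrow> 2 * 0 + 2 * 0"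
    by (intro tendsto_add ennreal_tendsto_cmult assms) auto
  then show "(\<lambda>n. 2 * L2 x (f n) + 2 * L2 x (g n)) \<longlonglongrightarrow> 0" by simp
qed (use assms in \<open>auto intro!: always_eventually L2_le_two\<close>)

text \<open>The approximating sequence depends on \<open>f\<close> only, so it serves all vectors in the domain of
  \<open>\<integral> f dE\<close> simultaneously; linearity in the vector then passes to the limit.\<close>

definition approx :: "(real \<Rightarrow> real) \<Rightarrow> nat \<Rightarrow> real \<Rightarrow> real"
  where "approx f = (SOME s. (\<forall>n. simple_function borel (s n)) \<and> (\<forall>t. (\<lambda>n. s n t) \<longlonglongrightarrow> f t)
    \<and> (\<forall>n t. \<bar>s n t\<bar> \<le> 2 * \<bar>f t\<bar>))"

lemma approx:
  assumes "f \<in> borel_measurable borel"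
  shows "simple_function borel (approx f n)" "(\<lambda>n. approx f n t) \<longlonglongrightarrow> f t" "\<bar>approx f n t\<bar> \<le> 2 * \<bar>f t\<bar>"
proof -
  have "\<exists>s. (\<forall>n. simple_function borel (s n)) \<and> (\<forall>t. (\<lambda>n. s n t) \<longlonglongrightarrow> f t)
    \<and> (\<forall>n t. \<bar>s n t\<bar> \<le> 2 * \<bar>f t\<bar>)"
    using borel_measurable_implies_sequence_metric[OF assms, of 0] by (simp add: dist_real_def)
  from someI_ex[OF this, folded approx_def]
  show "simple_function borel (approx f n)" "(\<lambda>n. approx f n t) \<longlonglongrightarrow> f t" "\<bar>approx f n t\<bar> \<le> 2 * \<bar>f t\<bar>"
    by auto
qed

lemma approx_power2_le:
  assumes "f \<in> borel_measurable borel" shows "(approx f n t)\<^sup>2 \<le> 4 * (f t)\<^sup>2"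
proof -
  have "(approx f n t)\<^sup>2 \<le> (2 * f t)\<^sup>2"
    using approx(3)[OF assms, of n t] by (intro abs_le_square_iff[THEN iffD1]) (simp add: abs_mult)
  then show ?thesis by simp
qed

lemma simple_measurable: "simple_function borel s \<Longrightarrow> (s :: real \<Rightarrow> real) \<in> borel_measurable borel"
  by (rule borel_measurable_simple_function)

lemma approx_measurable [measurable]: "f \<in> borel_measurable borel \<Longrightarrow> approx f n \<in> borel_measurable borel"
  by (rule simple_measurable, rule approx)

lemma approx_L2:
  assumes [measurable]: "f \<in> borel_measurable borel" and "L2 x f < \<infinity>"
  shows "(\<lambda>n. L2 x (\<lambda>t. f t - approx f n t)) \<longlonglongrightarrow> 0"
proof -
  have "(\<lambda>n. \<integral>\<^sup>+ t. ennreal ((f t - approx f n t)\<^sup>2) \<partial>\<mu> x) \<longlonglongrightarrow> (\<integral>\<^sup>+ t. 0 \<partial>\<mu> x)"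
  \<comment> \<open>10 = 2 + 2 * 4, from \<open>power2_diff_le\<close> and the bound 4 of
    \<open>approx_power2_le\<close>.\<close>
  proof (rule nn_integral_dominated_convergence[where w = "\<lambda>t. 10 * ennreal ((f t)\<^sup>2)"])
    show "(\<integral>\<^sup>+ t. 10 * ennreal ((f t)\<^sup>2) \<partial>\<mu> x) < \<infinity>"
      using assms(2) by (simp add: nn_integral_cmult L2_def ennreal_mult_less_top)
    show "AE t in \<mu> x. (\<lambda>n. ennreal ((f t - approx f n t)\<^sup>2)) \<longlonglongrightarrow> 0"
    proof (rule AE_I2)
      fix t
      have "(\<lambda>n. (f t - approx f n t)\<^sup>2) \<longlonglongrightarrow> (f t - f t)\<^sup>2"
        by (intro tendsto_intros approx assms)
      then show "(\<lambda>n. ennreal ((f t - approx f n t)\<^sup>2)) \<longlonglongrightarrow> 0"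
        using tendsto_ennrealI by fastforce
    qed
    show "AE t in \<mu> x. ennreal ((f t - approx f n t)\<^sup>2) \<le> 10 * ennreal ((f t)\<^sup>2)" for n
    proof (rule AE_I2)
      fix t
      have "(f t - approx f n t)\<^sup>2 \<le> 10 * (f t)\<^sup>2"
        using power2_diff_le[of "f t" "approx f n t"] approx_power2_le[OF assms(1), of n t] by simp
      then have "ennreal ((f t - approx f n t)\<^sup>2) \<le> ennreal (10 * (f t)\<^sup>2)" by (rule ennreal_leI)
      then show "ennreal ((f t - approx f n t)\<^sup>2) \<le> 10 * ennreal ((f t)\<^sup>2)" by (simp add: ennreal_mult')
    qed
  qed auto
  then show ?thesis by (simp add: L2_def)
qed

section \<open>Graphs of spectral integrals\<close>

abbreviation Sp :: "(real \<Rightarrow> real) \<Rightarrow> 'a graph" where "Sp \<equiv> spectral_integral E"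

lemma SpI:
  assumes "L2 x f < \<infinity>" "\<And>n. simple_function borel (s n)"
    "(\<lambda>n. L2 x (\<lambda>t. f t - s n t)) \<longlonglongrightarrow> 0" "(\<lambda>n::nat. simple_integral E (s n) x) \<longlonglongrightarrow> y"
  shows "(x, y) \<in> Sp f"
  using assms unfolding spectral_integral_def L2_def by auto

lemma tendsto_zero_if_power2:
  assumes "(\<lambda>n. ennreal ((norm (u n))\<^sup>2)) \<longlonglongrightarrow> 0" shows "u \<longlonglongrightarrow> 0"
proof -
  have "(\<lambda>n. (norm (u n))\<^sup>2) \<longlonglongrightarrow> 0" using assms by (simp add: ennreal_tendsto_0_iff)
  then have "(\<lambda>n. sqrt ((norm (u n))\<^sup>2)) \<longlonglongrightarrow> sqrt 0" by (rule tendsto_real_sqrt)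
  then show ?thesis by (simp add: tendsto_norm_zero_iff)
qed

text \<open>The isometry turns L2 closeness of two approximating sequences into closeness of the
  vectors, so the value does not depend on the chosen sequence.\<close>

lemma simple_same_limit:
  assumes [measurable]: "f \<in> borel_measurable borel"
    and s: "\<And>n. simple_function borel (s n)" "\<And>n. simple_function borel (r n)"
    and "(\<lambda>n. L2 x (\<lambda>t. f t - s n t)) \<longlonglongrightarrow> 0" "(\<lambda>n. L2 x (\<lambda>t. f t - r n t)) \<longlonglongrightarrow> 0"
  shows "(\<lambda>n. simple_integral E (s n) x - simple_integral E (r n) x) \<longlonglongrightarrow> 0"
proof (rule tendsto_zero_if_power2)
  note [measurable] = s[THEN simple_measurable]
  have "(\<lambda>n. L2 x (\<lambda>t. s n t - r n t)) \<longlonglongrightarrow> 0"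
  proof (rule L2_tendsto_zero[OF _ _ _ assms(4,5)])
    show "(s n t - r n t)\<^sup>2 \<le> 2 * (f t - s n t)\<^sup>2 + 2 * (f t - r n t)\<^sup>2" for n t
      using power2_diff_le[of "f t - r n t" "f t - s n t"] by simp
  qed simp_all
  then show "(\<lambda>n. ennreal ((norm (simple_integral E (s n) x - simple_integral E (r n) x))\<^sup>2)) \<longlonglongrightarrow> 0"
    by (simp add: simple_diff[symmetric] simple_isometry s simple_function_diff)
qed

text \<open>Replaces the existentially quantified sequence by the fixed \<open>approx f\<close>, so
  that membership for different vectors can be compared along one sequence.\<close>

lemma Sp_iff:
  assumes f: "f \<in> borel_measurable borel"
  shows "(x, y) \<in> Sp f \<longleftrightarrow> L2 x f < \<infinity> \<and> (\<lambda>n. simple_integral E (approx f n) x) \<longlonglongrightarrow> y"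
proof
  assume "(x, y) \<in> Sp f"
  then obtain s where s: "L2 x f < \<infinity>" "\<And>n. simple_function borel (s n)"
    "(\<lambda>n. L2 x (\<lambda>t. f t - s n t)) \<longlonglongrightarrow> 0" "(\<lambda>n::nat. simple_integral E (s n) x) \<longlonglongrightarrow> y"
    unfolding spectral_integral_def L2_def by blast
  have "(\<lambda>n. simple_integral E (approx f n) x - simple_integral E (s n) x) \<longlonglongrightarrow> 0"
    by (intro simple_same_limit[of f] s approx approx_L2 f)
  from tendsto_add[OF this s(4)] s(1)
  show "L2 x f < \<infinity> \<and> (\<lambda>n. simple_integral E (approx f n) x) \<longlonglongrightarrow> y" by simp
next
  assume "L2 x f < \<infinity> \<and> (\<lambda>n. simple_integral E (approx f n) x) \<longlonglongrightarrow> y"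
  then show "(x, y) \<in> Sp f" by (intro SpI[where s = "approx f"] approx approx_L2 f) auto
qed

lemma Sp_unique: "f \<in> borel_measurable borel \<Longrightarrow> (x, y) \<in> Sp f \<Longrightarrow> (x, z) \<in> Sp f \<Longrightarrow> y = z"
  by (auto simp: Sp_iff intro: LIMSEQ_unique)

lemma Sp_ex:
  assumes f [measurable]: "f \<in> borel_measurable borel" and fin: "L2 x f < \<infinity>"
  obtains y where "(x, y) \<in> Sp f"
proof -
  let ?d = "\<lambda>n. L2 x (\<lambda>t. f t - approx f n t)"
  have "Cauchy (\<lambda>n. simple_integral E (approx f n) x)"
  proof (rule metric_CauchyI)
    fix e :: real assume "e > 0"
    \<comment> \<open>The bound e^2/4 is chosen because \<open>L2_le_two\<close> yields 2 * (e^2/4)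
      + 2 * (e^2/4) = e^2.\<close>
    then have "\<forall>\<^sub>F n in sequentially. ?d n < ennreal (e\<^sup>2 / 4)"
      by (intro order_tendstoD[OF approx_L2[OF f fin]]) simp
    then obtain N where N: "\<And>n. n \<ge> N \<Longrightarrow> ?d n < ennreal (e\<^sup>2 / 4)"
      by (auto simp: eventually_sequentially)
    show "\<exists>N. \<forall>m\<ge>N. \<forall>n\<ge>N. dist (simple_integral E (approx f m) x) (simple_integral E (approx f n) x) < e"
    proof (intro exI allI impI)
      fix m n assume mn: "N \<le> m" "N \<le> n"
      let ?u = "simple_integral E (approx f m) x - simple_integral E (approx f n) x"
      have "ennreal ((norm ?u)\<^sup>2) = L2 x (\<lambda>t. approx f m t - approx f n t)"
        by (simp add: simple_diff[symmetric] simple_isometry approx f simple_function_diff)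
      also have "\<dots> \<le> 2 * ?d m + 2 * ?d n"
      proof (rule L2_le_two)
        show "(approx f m t - approx f n t)\<^sup>2 \<le> 2 * (f t - approx f m t)\<^sup>2 + 2 * (f t - approx f n t)\<^sup>2" for t
          using power2_diff_le[of "f t - approx f n t" "f t - approx f m t"] by simp
      qed auto
      also have "\<dots> < ennreal (e\<^sup>2 / 2) + ennreal (e\<^sup>2 / 2)"
      proof (rule add_strict_mono)
        have "2 * d < ennreal (e\<^sup>2 / 2)" if "d < ennreal (e\<^sup>2 / 4)" for d
        proof -
          have "2 * d < 2 * ennreal (e\<^sup>2 / 4)"
            using that by (intro ennreal_mult_strict_left_mono) auto
          also have "\<dots> = ennreal (2 * (e\<^sup>2 / 4))" by (simp only: ennreal_mult' ennreal_numeral)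
          finally show ?thesis by simp
        qed
        then show "2 * ?d m < ennreal (e\<^sup>2 / 2)" "2 * ?d n < ennreal (e\<^sup>2 / 2)"
          using N mn by blast+
      qed
      also have "\<dots> = ennreal (e\<^sup>2)" by (simp add: ennreal_plus[symmetric] del: ennreal_plus)
      finally have "(norm ?u)\<^sup>2 < e\<^sup>2" by (simp add: ennreal_less_iff)
      then show "dist (simple_integral E (approx f m) x) (simple_integral E (approx f n) x) < e"
        using \<open>e > 0\<close> by (simp add: dist_norm power2_less_imp_less)
    qed
  qed
  then obtain y where "(\<lambda>n. simple_integral E (approx f n) x) \<longlonglongrightarrow> y"
    using Cauchy_convergent convergentD by blast
  then show ?thesis using that fin f Sp_iff by blast
qed

lemma Domain_Sp: "f \<in> borel_measurable borel \<Longrightarrow> x \<in> Domain (Sp f) \<longleftrightarrow> L2 x f < \<infinity>"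
  by (metis Domain.DomainI Domain.cases Sp_ex Sp_iff)

text \<open>The isometry for simple functions passes to the limit: the vectors converge in norm, the
  integrals by dominated convergence.\<close>

lemma Sp_norm:
  assumes f [measurable]: "f \<in> borel_measurable borel" and "(x, y) \<in> Sp f"
  shows "ennreal ((norm y)\<^sup>2) = L2 x f"
proof (rule LIMSEQ_unique)
  have y: "L2 x f < \<infinity>" "(\<lambda>n. simple_integral E (approx f n) x) \<longlonglongrightarrow> y"
    using assms Sp_iff by auto
  show "(\<lambda>n. ennreal ((norm (simple_integral E (approx f n) x))\<^sup>2)) \<longlonglongrightarrow> ennreal ((norm y)\<^sup>2)"
    by (intro tendsto_ennrealI tendsto_intros y)
  have "(\<lambda>n. \<integral>\<^sup>+ t. ennreal ((approx f n t)\<^sup>2) \<partial>\<mu> x) \<longlonglongrightarrow> (\<integral>\<^sup>+ t. ennreal ((f t)\<^sup>2) \<partial>\<mu> x)"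
  proof (rule nn_integral_dominated_convergence[where w = "\<lambda>t. 4 * ennreal ((f t)\<^sup>2)"])
    show "(\<integral>\<^sup>+ t. 4 * ennreal ((f t)\<^sup>2) \<partial>\<mu> x) < \<infinity>"
      using y(1) by (simp add: nn_integral_cmult L2_def ennreal_mult_less_top)
    show "AE t in \<mu> x. (\<lambda>n. ennreal ((approx f n t)\<^sup>2)) \<longlonglongrightarrow> ennreal ((f t)\<^sup>2)"
      by (intro AE_I2 tendsto_ennrealI tendsto_intros approx f)
    show "AE t in \<mu> x. ennreal ((approx f n t)\<^sup>2) \<le> 4 * ennreal ((f t)\<^sup>2)" for n
    proof (rule AE_I2)
      fix t
      have "ennreal ((approx f n t)\<^sup>2) \<le> ennreal (4 * (f t)\<^sup>2)"
        by (intro ennreal_leI approx_power2_le f)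
      then show "ennreal ((approx f n t)\<^sup>2) \<le> 4 * ennreal ((f t)\<^sup>2)" by (simp add: ennreal_mult')
    qed
  qed auto
  then show "(\<lambda>n. ennreal ((norm (simple_integral E (approx f n) x))\<^sup>2)) \<longlonglongrightarrow> L2 x f"
    by (simp add: simple_isometry approx f) (simp add: L2_def)
qed

lemma Sp_add:
  assumes [measurable]: "f \<in> borel_measurable borel" "g \<in> borel_measurable borel"
    and "(x, y) \<in> Sp f" "(x, z) \<in> Sp g"
  shows "(x, y + z) \<in> Sp (\<lambda>t. f t + g t)"
proof (rule SpI[where s = "\<lambda>n t. approx f n t + approx g n t"])
  have fin: "L2 x f < \<infinity>" "L2 x g < \<infinity>" using assms by (auto simp: Sp_iff)
  have "L2 x (\<lambda>t. f t + g t) \<le> 2 * L2 x f + 2 * L2 x g"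
    by (rule L2_le_two) (auto simp: power2_add_le)
  also have "\<dots> < \<infinity>" using fin by (simp add: ennreal_mult_less_top)
  finally show "L2 x (\<lambda>t. f t + g t) < \<infinity>" .
  show "(\<lambda>n. L2 x (\<lambda>t. f t + g t - (approx f n t + approx g n t))) \<longlonglongrightarrow> 0"
  proof (rule L2_tendsto_zero[OF _ _ _ approx_L2 approx_L2])
    show "(f t + g t - (approx f n t + approx g n t))\<^sup>2
      \<le> 2 * (f t - approx f n t)\<^sup>2 + 2 * (g t - approx g n t)\<^sup>2" for n t
      using power2_add_le[of "f t - approx f n t" "g t - approx g n t"] by (simp add: algebra_simps)
  qed (use fin in auto)
  show "(\<lambda>n. simple_integral E (\<lambda>t. approx f n t + approx g n t) x) \<longlonglongrightarrow> y + z"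
    using assms by (simp add: simple_add approx Sp_iff tendsto_add)
qed (intro simple_function_add approx assms)

lemma Sp_simple:
  assumes "simple_function borel s" shows "(x, simple_integral E s x) \<in> Sp s"
proof (rule SpI[where s = "\<lambda>n. s"])
  show "L2 x s < \<infinity>" using simple_isometry[OF assms, of x] by (metis ennreal_less_top infinity_ennreal_def)
qed (use assms in \<open>simp_all add: L2_def\<close>)

lemma Sp_const: "(x, c *\<^sub>R x) \<in> Sp (\<lambda>t. c)"
  using Sp_simple[of "\<lambda>t. c" x] by (simp add: simple_integral_def E_UNIV vimage_def)

lemma Sp_indicator: "B \<in> sets borel \<Longrightarrow> (x, E B x) \<in> Sp (indicat_real B)"
  using Sp_simple[of "indicat_real B" x] by (simp add: simple_indicator)

section \<open>Product rule\<close>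

text \<open>A simple outer factor is bounded, so multiplying by it preserves L2 convergence, and its
  simple integral is a continuous operator. This case is the seed of the general product
  rule.\<close>

lemma Sp_simple_comp:
  assumes f [measurable]: "f \<in> borel_measurable borel" and y: "(x, y) \<in> Sp f"
    and s: "simple_function borel s"
  shows "(x, simple_integral E s y) \<in> Sp (\<lambda>t. s t * f t)"
proof (rule SpI[where s = "\<lambda>n t. s t * approx f n t"])
  note [measurable] = simple_measurable[OF s]
  obtain C where C: "\<And>t. (s t)\<^sup>2 \<le> C" "C \<ge> 0"
  proof -
    have "finite (range (\<lambda>t. (s t)\<^sup>2))"
      using finite_imageI[OF simple_fiber(1)[OF s], of "\<lambda>v. v\<^sup>2"] by (simp add: image_image)
    then have "(s t)\<^sup>2 \<le> Max (range (\<lambda>t. (s t)\<^sup>2))" for t by (intro Max_ge) auto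
    then show ?thesis using that zero_le_power2 order_trans by metis
  qed
  have le: "L2 x (\<lambda>t. s t * g t) \<le> ennreal C * L2 x g" if [measurable]: "g \<in> borel_measurable borel" for g
  proof -
    have "L2 x (\<lambda>t. s t * g t) \<le> (\<integral>\<^sup>+ t. ennreal C * ennreal ((g t)\<^sup>2) \<partial>\<mu> x)"
      unfolding L2_def
      by (intro nn_integral_mono)
         (auto simp: ennreal_mult[symmetric] C power_mult_distrib intro!: ennreal_leI mult_right_mono)
    then show ?thesis by (simp add: nn_integral_cmult L2_def)
  qed
  have fin: "L2 x f < \<infinity>" and lim: "(\<lambda>n. simple_integral E (approx f n) x) \<longlonglongrightarrow> y"
    using y by (auto simp: Sp_iff)
  show "L2 x (\<lambda>t. s t * f t) < \<infinity>"
    using le[OF f] fin by (simp add: ennreal_mult_less_top order_le_less_trans)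
  have "(\<lambda>n. ennreal C * L2 x (\<lambda>t. f t - approx f n t)) \<longlonglongrightarrow> ennreal C * 0"
    by (intro ennreal_tendsto_cmult approx_L2 f fin) auto
  then have *: "(\<lambda>n. ennreal C * L2 x (\<lambda>t. f t - approx f n t)) \<longlonglongrightarrow> 0" by simp
  have "(\<lambda>n. L2 x (\<lambda>t. s t * (f t - approx f n t))) \<longlonglongrightarrow> 0"
    by (rule tendsto_sandwich[OF _ _ tendsto_const *]) (auto intro!: always_eventually le)
  then show "(\<lambda>n. L2 x (\<lambda>t. s t * f t - s t * approx f n t)) \<longlonglongrightarrow> 0"
    by (simp add: right_diff_distrib)
  show "(\<lambda>n. simple_integral E (\<lambda>t. s t * approx f n t) x) \<longlonglongrightarrow> simple_integral E s y"
    using bounded_linear.tendsto[OF bounded_linear_simple[OF s] lim] by (simp add: simple_mult s approx f)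
qed (intro simple_function_mult approx s f)

text \<open>With an indicator as outer factor, the norm identity expresses the squared norm of
  \<open>E B y\<close> as the integral of the squared \<open>f\<close> over \<open>B\<close>. Domain
  conditions at \<open>y\<close> thereby become domain conditions at \<open>x\<close>.\<close>

lemma \<mu>_density:
  assumes f [measurable]: "f \<in> borel_measurable borel" and y: "(x, y) \<in> Sp f"
  shows "\<mu> y = density (\<mu> x) (\<lambda>t. ennreal ((f t)\<^sup>2))"
proof (rule measure_eqI)
  fix B assume "B \<in> sets (\<mu> y)"
  then have B [measurable]: "B \<in> sets borel" by simp
  have "(x, E B y) \<in> Sp (\<lambda>t. indicat_real B t * f t)"
    using Sp_simple_comp[OF f y, of "indicat_real B"] by (simp add: simple_indicator)
  then have "emeasure (\<mu> y) B = L2 x (\<lambda>t. indicat_real B t * f t)"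
    by (subst Sp_norm[symmetric]) (auto simp: emeasure_\<mu>)
  also have "\<dots> = (\<integral>\<^sup>+ t. ennreal ((f t)\<^sup>2) * indicator B t \<partial>\<mu> x)"
    unfolding L2_def by (intro nn_integral_cong) (auto simp: indicator_def)
  also have "\<dots> = emeasure (density (\<mu> x) (\<lambda>t. ennreal ((f t)\<^sup>2))) B"
    by (simp add: emeasure_density)
  finally show "emeasure (\<mu> y) B = emeasure (density (\<mu> x) (\<lambda>t. ennreal ((f t)\<^sup>2))) B" .
qed simp

lemma L2_comp:
  assumes [measurable]: "f \<in> borel_measurable borel" "g \<in> borel_measurable borel" and "(x, y) \<in> Sp f"
  shows "L2 y g = L2 x (\<lambda>t. g t * f t)"
  unfolding L2_def \<mu>_density[OF assms(1,3)]
  by (simp add: nn_integral_density power_mult_distrib ennreal_mult mult.commute)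

text \<open>Once \<open>y\<close> is given, \<open>L2_comp\<close> identifies the two finiteness
  conditions, which is why this is an equivalence and not just an inclusion.\<close>

lemma Sp_comp:
  assumes f [measurable]: "f \<in> borel_measurable borel" and g [measurable]: "g \<in> borel_measurable borel"
    and y: "(x, y) \<in> Sp f"
  shows "(y, z) \<in> Sp g \<longleftrightarrow> (x, z) \<in> Sp (\<lambda>t. g t * f t)"
proof -
  have *: "(x, z) \<in> Sp (\<lambda>t. g t * f t)" if "(y, z) \<in> Sp g" for z
  proof -
    have fin: "L2 y g < \<infinity>" and lim: "(\<lambda>n. simple_integral E (approx g n) y) \<longlonglongrightarrow> z"
      using that by (auto simp: Sp_iff)
    obtain w where w: "(x, w) \<in> Sp (\<lambda>t. g t * f t)"
      using fin L2_comp[OF f g y] Sp_ex[of "\<lambda>t. g t * f t" x] by auto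
    \<comment> \<open>Both vectors are spectral integrals at \<open>x\<close>, so the norm of their
      difference can be computed there; moved back to \<open>y\<close>, it is exactly the
      approximation error of \<open>g\<close>.\<close>
    have "(\<lambda>n. simple_integral E (approx g n) y - w) \<longlonglongrightarrow> 0"
    proof (rule tendsto_zero_if_power2)
      have "ennreal ((norm (simple_integral E (approx g n) y - w))\<^sup>2) = L2 y (\<lambda>t. g t - approx g n t)" for n
      proof -
        have "(x, - w) \<in> Sp (\<lambda>t. - (g t * f t))"
          using Sp_simple_comp[OF _ w, of "\<lambda>t. -1"] by (simp add: simple_integral_def E_UNIV vimage_def)
        then have "(x, simple_integral E (approx g n) y + - w) \<in> Sp (\<lambda>t. approx g n t * f t + - (g t * f t))"
          by (intro Sp_add Sp_simple_comp y approx) auto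
        then have "ennreal ((norm (simple_integral E (approx g n) y - w))\<^sup>2)
            = L2 x (\<lambda>t. approx g n t * f t + - (g t * f t))"
          by (subst Sp_norm[symmetric]) auto
        also have "\<dots> = L2 x (\<lambda>t. (g t - approx g n t) * f t)"
          unfolding L2_def by (intro nn_integral_cong arg_cong[where f = ennreal]) (simp add: power2_eq_square algebra_simps)
        also have "\<dots> = L2 y (\<lambda>t. g t - approx g n t)"
          by (subst L2_comp[OF f _ y]) auto
        finally show ?thesis .
      qed
      then show "(\<lambda>n. ennreal ((norm (simple_integral E (approx g n) y - w))\<^sup>2)) \<longlonglongrightarrow> 0"
        using approx_L2[OF g fin] by simp
    qed
    then have "w = z" using lim by (metis LIM_zero_cancel LIMSEQ_unique)
    then show ?thesis using w by simp
  qed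
  moreover have "(y, z) \<in> Sp g" if z: "(x, z) \<in> Sp (\<lambda>t. g t * f t)"
  proof -
    have "L2 y g < \<infinity>" using z L2_comp[OF f g y] by (simp add: Sp_iff)
    then obtain w where w: "(y, w) \<in> Sp g" using Sp_ex g by blast
    then have "z = w" using *[OF w] z by (intro Sp_unique[of "\<lambda>t. g t * f t"]) auto
    then show ?thesis using w by simp
  qed
  ultimately show ?thesis by blast
qed

text \<open>\<open>E B\<close> after \<open>f\<close> and \<open>f\<close> after \<open>E B\<close>
  both belong to the product of \<open>f\<close> with the indicator of \<open>B\<close>.\<close>

lemma E_Sp:
  assumes f [measurable]: "f \<in> borel_measurable borel" and y: "(x, y) \<in> Sp f" and B: "B \<in> sets borel"
  shows "(E B x, E B y) \<in> Sp f"
  using Sp_simple_comp[OF f y, of "indicat_real B"] Sp_comp[OF _ f Sp_indicator[OF B], of x "E B y"] B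
  by (simp add: simple_indicator mult.commute)

lemma Sp_inner:
  assumes "f \<in> borel_measurable borel" "(x, y) \<in> Sp f" "(u, v) \<in> Sp f"
  shows "inner y u = inner x v"
proof (rule LIMSEQ_unique)
  show "(\<lambda>n. inner (simple_integral E (approx f n) x) u) \<longlonglongrightarrow> inner y u"
    using assms by (intro tendsto_intros) (auto simp: Sp_iff)
  have "(\<lambda>n. inner x (simple_integral E (approx f n) u)) \<longlonglongrightarrow> inner x v"
    using assms by (intro tendsto_intros) (auto simp: Sp_iff)
  then show "(\<lambda>n. inner (simple_integral E (approx f n) x) u) \<longlonglongrightarrow> inner x v"
    using assms by (simp add: simple_inner approx)
qed

section \<open>Linearity in the vector\<close>

text \<open>The scalar measure is not additive in the vector. The inequality is therefore checked on
  simple functions, where the isometry reduces it to norms, and carried over to \<open>f\<close> by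
  Fatou's lemma along \<open>approx f\<close>.\<close>

lemma L2_finite_transfer:
  assumes f [measurable]: "f \<in> borel_measurable borel"
    and le: "\<And>s. simple_function borel s \<Longrightarrow> L2 z s \<le> ennreal K * (L2 x s + L2 y s)"
    and fin: "L2 x f < \<infinity>" "L2 y f < \<infinity>"
  shows "L2 z f < \<infinity>"
proof -
  have bound: "L2 u (approx f n) \<le> 4 * L2 u f" for n u
  proof -
    have "L2 u (approx f n) \<le> (\<integral>\<^sup>+ t. 4 * ennreal ((f t)\<^sup>2) \<partial>\<mu> u)"
      unfolding L2_def
    proof (rule nn_integral_mono)
      fix t
      have "ennreal ((approx f n t)\<^sup>2) \<le> ennreal (4 * (f t)\<^sup>2)"
        by (intro ennreal_leI approx_power2_le f)
      then show "ennreal ((approx f n t)\<^sup>2) \<le> 4 * ennreal ((f t)\<^sup>2)" by (simp add: ennreal_mult')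
    qed
    then show ?thesis by (simp add: nn_integral_cmult L2_def)
  qed
  have "L2 z f = (\<integral>\<^sup>+ t. liminf (\<lambda>n. ennreal ((approx f n t)\<^sup>2)) \<partial>\<mu> z)"
    unfolding L2_def
  proof (rule nn_integral_cong)
    fix t
    have "(\<lambda>n. ennreal ((approx f n t)\<^sup>2)) \<longlonglongrightarrow> ennreal ((f t)\<^sup>2)"
      by (intro tendsto_ennrealI tendsto_intros approx f)
    then show "ennreal ((f t)\<^sup>2) = liminf (\<lambda>n. ennreal ((approx f n t)\<^sup>2))"
      by (metis lim_imp_Liminf sequentially_bot)
  qed
  also have "\<dots> \<le> liminf (\<lambda>n. L2 z (approx f n))"
    unfolding L2_def by (rule nn_integral_liminf) simp
  also have "\<dots> \<le> liminf (\<lambda>n::nat. ennreal K * (4 * L2 x f + 4 * L2 y f))"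
  proof (rule Liminf_mono, rule always_eventually, rule allI)
    fix n
    have "L2 z (approx f n) \<le> ennreal K * (L2 x (approx f n) + L2 y (approx f n))"
      by (intro le approx f)
    also have "\<dots> \<le> ennreal K * (4 * L2 x f + 4 * L2 y f)"
      by (intro mult_left_mono add_mono bound) auto
    finally show "L2 z (approx f n) \<le> ennreal K * (4 * L2 x f + 4 * L2 y f)" .
  qed
  also have "\<dots> = ennreal K * (4 * L2 x f + 4 * L2 y f)" by (simp add: Liminf_const)
  also have "\<dots> < \<infinity>" using fin by (simp add: ennreal_mult_less_top)
  finally show ?thesis .
qed

lemma Sp_add_vec:
  assumes f: "f \<in> borel_measurable borel" and "(x, y) \<in> Sp f" "(u, v) \<in> Sp f"
  shows "(x + u, y + v) \<in> Sp f"
proof -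
  have add: "simple_integral E s (x + u) = simple_integral E s x + simple_integral E s u"
    if "simple_function borel s" for s
    using that by (metis bounded_linear.linear bounded_linear_simple linear_add)
  have "L2 (x + u) f < \<infinity>"
  proof (rule L2_finite_transfer[OF f, of _ 2])
    fix s assume s: "simple_function borel (s :: real \<Rightarrow> real)"
    let ?a = "simple_integral E s x" and ?b = "simple_integral E s u"
    have "(norm (?a + ?b))\<^sup>2 \<le> (norm ?a + norm ?b)\<^sup>2"
      by (intro power_mono norm_triangle_ineq) auto
    also have "\<dots> \<le> 2 * ((norm ?a)\<^sup>2 + (norm ?b)\<^sup>2)"
      using power2_add_le[of "norm ?a" "norm ?b"] by simp
    finally have "ennreal ((norm (?a + ?b))\<^sup>2) \<le> ennreal (2 * ((norm ?a)\<^sup>2 + (norm ?b)\<^sup>2))"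
      by (rule ennreal_leI)
    then show "L2 (x + u) s \<le> ennreal 2 * (L2 x s + L2 u s)"
      by (simp add: simple_isometry[OF s, symmetric] add[OF s] ennreal_mult'[symmetric]
          ennreal_plus[symmetric] del: ennreal_plus ennreal_numeral)
  qed (use assms in \<open>auto simp: Sp_iff\<close>)
  then show ?thesis using assms by (simp add: Sp_iff add approx tendsto_add)
qed

lemma Sp_scaleC_vec:
  assumes f: "f \<in> borel_measurable borel" and "(x, y) \<in> Sp f"
  shows "(c *\<^sub>C x, c *\<^sub>C y) \<in> Sp f"
proof -
  have scale: "simple_integral E s (c *\<^sub>C x) = c *\<^sub>C simple_integral E s x"
    if "simple_function borel s" for s
    unfolding simple_integral_def
    by (simp add: E_scaleC simple_fiber[OF that] scaleR_scaleC scaleC_scaleC mult.commute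
        linear_sum[OF bounded_linear.linear[OF bounded_linear_scaleC]])
  have "L2 (c *\<^sub>C x) f < \<infinity>"
  proof (rule L2_finite_transfer[OF f, of _ "(cmod c)\<^sup>2" x x])
    fix s assume s: "simple_function borel (s :: real \<Rightarrow> real)"
    have "L2 (c *\<^sub>C x) s = ennreal ((cmod c)\<^sup>2) * L2 x s"
      by (simp add: simple_isometry[OF s, symmetric] scale[OF s] norm_scaleC power_mult_distrib ennreal_mult)
    also have "\<dots> \<le> ennreal ((cmod c)\<^sup>2) * (L2 x s + L2 x s)"
      by (intro mult_left_mono) auto
    finally show "L2 (c *\<^sub>C x) s \<le> ennreal ((cmod c)\<^sup>2) * (L2 x s + L2 x s)" .
  qed (use assms in \<open>auto simp: Sp_iff\<close>)
  then show ?thesis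
    using assms by (auto simp: Sp_iff scale approx intro: bounded_linear.tendsto[OF bounded_linear_scaleC])
qed

section \<open>Localisation on ranges of spectral projections\<close>

lemma AE_range:
  assumes "B \<in> sets borel" "E B x = x" shows "AE t in \<mu> x. t \<in> B"
proof (rule AE_I)
  show "emeasure (\<mu> x) (- B) = 0"
    using E_Int[of "- B" B x] assms by (simp add: emeasure_\<mu> E_empty)
qed (use assms in auto)

text \<open>The scalar measure of \<open>x\<close> is concentrated on \<open>B\<close>. This is the
  device by which identities valid only on part of the line are used.\<close>

lemma Sp_cong:
  assumes "B \<in> sets borel" "E B x = x" "\<And>t. t \<in> B \<Longrightarrow> f t = g t"
  shows "(x, y) \<in> Sp f \<longleftrightarrow> (x, y) \<in> Sp g"
proof -
  have AE: "AE t in \<mu> x. f t = g t"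
    using AE_range[OF assms(1,2)] by eventually_elim (rule assms(3))
  have "(\<integral>\<^sup>+ t. ennreal ((f t)\<^sup>2) \<partial>\<mu> x) = (\<integral>\<^sup>+ t. ennreal ((g t)\<^sup>2) \<partial>\<mu> x)"
    "(\<integral>\<^sup>+ t. ennreal ((f t - s t)\<^sup>2) \<partial>\<mu> x) = (\<integral>\<^sup>+ t. ennreal ((g t - s t)\<^sup>2) \<partial>\<mu> x)" for s
    using AE by (auto intro!: nn_integral_cong_AE elim!: eventually_mono)
  then show ?thesis unfolding spectral_integral_def by simp
qed

lemma L2_le_const:
  assumes "B \<in> sets borel" "E B x = x" "\<And>t. t \<in> B \<Longrightarrow> (f t)\<^sup>2 \<le> C"
  shows "L2 x f \<le> ennreal C * ennreal ((norm x)\<^sup>2)"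
proof -
  have "L2 x f \<le> (\<integral>\<^sup>+ t. ennreal C \<partial>\<mu> x)"
    unfolding L2_def using AE_range[OF assms(1,2)] assms(3)
    by (intro nn_integral_mono_AE) (auto intro: ennreal_leI)
  then show ?thesis by (simp add: emeasure_\<mu> E_UNIV)
qed

lemma subspace_Domain_Sp: assumes "f \<in> borel_measurable borel" shows "subspace (Domain (Sp f))"
proof (rule subspaceI)
  show "0 \<in> Domain (Sp f)"
    \<comment> \<open>The zero vector is carried by the empty set, where the bound 0 holds
      vacuously.\<close>
    using assms L2_le_const[of "{}" 0 f 0] by (simp add: Domain_Sp E_empty)
next
  show "x + y \<in> Domain (Sp f)" if "x \<in> Domain (Sp f)" "y \<in> Domain (Sp f)" for x y
    using that Sp_add_vec[OF assms] by blast
  show "c *\<^sub>R x \<in> Domain (Sp f)" if "x \<in> Domain (Sp f)" for c x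
    using that Sp_scaleC_vec[OF assms] by (metis Domain.simps scaleR_scaleC)
qed

lemma L2_ge_const:
  assumes "B \<in> sets borel" "E B x = x" "\<And>t. t \<in> B \<Longrightarrow> C \<le> (f t)\<^sup>2"
  shows "ennreal C * ennreal ((norm x)\<^sup>2) \<le> L2 x f"
proof -
  have "(\<integral>\<^sup>+ t. ennreal C \<partial>\<mu> x) \<le> L2 x f"
    unfolding L2_def using AE_range[OF assms(1,2)] assms(3)
    by (intro nn_integral_mono_AE) (auto intro: ennreal_leI)
  then show ?thesis by (simp add: emeasure_\<mu> E_UNIV)
qed

text \<open>Boundedness on \<open>B\<close> makes the integral finite, and commutation with
  \<open>E B\<close> keeps the value in the range; the latter is what permits iteration.\<close>

lemma Sp_bounded_on:
  assumes "f \<in> borel_measurable borel" "B \<in> sets borel" "E B x = x" "\<And>t. t \<in> B \<Longrightarrow> (f t)\<^sup>2 \<le> C" "0 \<le> C"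
  obtains y where "(x, y) \<in> Sp f" "(norm y)\<^sup>2 \<le> C * (norm x)\<^sup>2" "E B y = y"
proof -
  have le: "L2 x f \<le> ennreal (C * (norm x)\<^sup>2)"
    using L2_le_const[OF assms(2-4)] assms(5) by (simp add: ennreal_mult)
  then have "L2 x f < \<infinity>" by (simp add: order_le_less_trans)
  then obtain y where y: "(x, y) \<in> Sp f" using Sp_ex assms(1) by blast
  have "(norm y)\<^sup>2 \<le> C * (norm x)\<^sup>2"
    using le Sp_norm[OF assms(1) y] assms(5) by (metis ennreal_le_iff mult_nonneg_nonneg zero_le_power2)
  moreover have "E B y = y"
    using E_Sp[OF assms(1) y assms(2)] y assms(1,3) by (metis Sp_unique)
  ultimately show ?thesis using that y by blast
qed

lemma Sp_bounded_below_on: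
  assumes "f \<in> borel_measurable borel" "B \<in> sets borel" "E B x = x" "\<And>t. t \<in> B \<Longrightarrow> C \<le> (f t)\<^sup>2" "0 \<le> C"
    "(x, y) \<in> Sp f"
  shows "C * (norm x)\<^sup>2 \<le> (norm y)\<^sup>2"
proof -
  have "ennreal (C * (norm x)\<^sup>2) \<le> ennreal ((norm y)\<^sup>2)"
    using L2_ge_const[OF assms(2-4)] Sp_norm[OF assms(1,6)] assms(5) by (simp add: ennreal_mult)
  then show ?thesis by (simp add: ennreal_le_iff)
qed

text \<open>The squared norm of \<open>x - E (B n) x\<close> is the measure of the complement of
  \<open>B n\<close>, so this is continuity from above of a finite measure.\<close>

lemma E_tendsto:
  assumes "range B \<subseteq> sets borel" "incseq B" "E (- (\<Union>n. B n)) x = 0"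
  shows "(\<lambda>n. E (B n) x) \<longlonglongrightarrow> x"
proof -
  have B: "B n \<in> sets borel" "- B n \<in> sets borel" for n using assms(1) by auto
  have UB: "- (\<Union>n. B n) \<in> sets borel" using B by (intro borel_comp sets.countable_UN) auto
  have "(\<lambda>n. emeasure (\<mu> x) (- B n)) \<longlonglongrightarrow> emeasure (\<mu> x) (\<Inter>n. - B n)"
    using assms(2) B
    by (intro Lim_emeasure_decseq) (auto simp: decseq_def incseq_def emeasure_\<mu>)
  also have "(\<Inter>n. - B n) = - (\<Union>n. B n)" by auto
  also have "emeasure (\<mu> x) (- (\<Union>n. B n)) = 0" using assms(3) UB by (simp add: emeasure_\<mu>)
  also have "(\<lambda>n. emeasure (\<mu> x) (- B n)) = (\<lambda>n. ennreal ((norm (x - E (B n) x))\<^sup>2))"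
  proof
    fix n
    have "E (- B n) x = x - E (B n) x"
      using E_Un[of "B n" "- B n" x] B[of n] by (simp add: E_UNIV) (metis add_diff_cancel_left')
    then show "emeasure (\<mu> x) (- B n) = ennreal ((norm (x - E (B n) x))\<^sup>2)" using B by (simp add: emeasure_\<mu>)
  qed
  finally have "(\<lambda>n. x - E (B n) x) \<longlonglongrightarrow> 0" by (rule tendsto_zero_if_power2)
  then have "(\<lambda>n. x - (x - E (B n) x)) \<longlonglongrightarrow> x - 0" by (intro tendsto_diff tendsto_const)
  then show ?thesis by simp
qed

text \<open>The sets may overlap, so the argument goes through null sets of the scalar measure
  instead of \<open>E_sums\<close>.\<close>

lemma E_UN_zero:
  assumes "\<And>n::nat. B n \<in> sets borel" "\<And>n. E (B n) x = 0"
  shows "E (\<Union>n. B n) x = 0"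
proof -
  have "emeasure (\<mu> x) (\<Union>n. B n) = 0"
    using assms by (intro emeasure_UN_eq_0) (auto simp: emeasure_\<mu>)
  then show ?thesis using assms(1) by (simp add: emeasure_\<mu> sets.countable_UN)
qed

lemma Sp_diff:
  assumes [measurable]: "f \<in> borel_measurable borel" "g \<in> borel_measurable borel"
    and y: "(x, y) \<in> Sp f" and z: "(x, z) \<in> Sp g"
  shows "(x, y - z) \<in> Sp (\<lambda>t. f t - g t)"
proof -
  have "(x, - z) \<in> Sp (\<lambda>t. - g t)"
    using Sp_simple_comp[OF _ z, of "\<lambda>t. -1"] by (simp add: simple_integral_def E_UNIV vimage_def)
  from Sp_add[OF _ _ y this] show ?thesis by simp
qed

end

section \<open>The functions of the modular operator\<close>

lemma powr_half_power2: "0 \<le> t \<Longrightarrow> (t powr (1/2))\<^sup>2 = (t::real)"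
  by (simp add: powr_half_sqrt)

lemma powr_minus_half: "t powr (-1/2) = inverse (t powr (1/2 :: real))"
  using powr_minus[of t "1/2"] by simp

lemma measurable_powers [measurable]:
  "(\<lambda>t::real. t powr (1/2)) \<in> borel_measurable borel"
  "(\<lambda>t::real. t powr (-1/2)) \<in> borel_measurable borel"
  "a_fun \<in> borel_measurable borel" "b_fun \<in> borel_measurable borel"
  unfolding a_fun_def b_fun_def by measurable

lemma sqrt_neq_one: "0 < t \<Longrightarrow> t \<noteq> 1 \<Longrightarrow> inverse (t powr (1/2)) - t powr (1/2) \<noteq> (0::real)"
proof
  assume t: "0 < t" "t \<noteq> 1" and "inverse (t powr (1/2)) - t powr (1/2) = (0::real)"
  then have "(t powr (1/2)) * (t powr (1/2)) = 1" by (simp add: field_simps)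
  then show False using t powr_half_power2[of t] by (simp add: power2_eq_square)
qed

lemma a_fun_eq: assumes "0 < t" "t \<noteq> 1" shows "a_fun t = 1 / (1 - t)"
proof -
  define r where "r = t powr (1/2)"
  have r: "r > 0" "r * r = t"
    using assms powr_half_power2[of t] by (auto simp: r_def power2_eq_square)
  have "inverse r - r \<noteq> 0" using sqrt_neq_one[OF assms] by (simp add: r_def)
  moreover have "r * (inverse r - r) = 1 - t" using r by (simp add: algebra_simps)
  ultimately show ?thesis
    unfolding a_fun_def powr_minus_half r_def[symmetric] by (metis inverse_eq_divide inverse_mult_distrib)
qed

text \<open>With \<open>sqrt_b_fun\<close>, this places (a x, b x) and (b x, a x - x) in the graph
  of the square root of the modular operator.\<close>

lemma sqrt_a_fun: "0 < t \<Longrightarrow> t powr (1/2) * a_fun t = b_fun t"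
  unfolding a_fun_def b_fun_def powr_minus_half by simp

lemma sqrt_b_fun: assumes "0 < t" "t \<noteq> 1" shows "t powr (1/2) * b_fun t = a_fun t - 1"
proof -
  have "t powr (1/2) * b_fun t = (t powr (1/2))\<^sup>2 * a_fun t"
    using sqrt_a_fun[OF assms(1)] by (simp add: power2_eq_square mult.assoc)
  also have "\<dots> = t / (1 - t)" using assms by (simp add: powr_half_power2 a_fun_eq)
  also have "\<dots> = a_fun t - 1" using assms by (simp add: a_fun_eq field_simps)
  finally show ?thesis .
qed

section \<open>Cutting projections\<close>

lemma subspace_symplectic_complement: "subspace (symplectic_complement H)"
proof (rule subspaceI)
  fix c :: real and k assume k: "k \<in> symplectic_complement H"
  have "inner (\<i> *\<^sub>C (c *\<^sub>R k)) h = c * inner (\<i> *\<^sub>C k) h" for h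
    using linear_cmul[OF bounded_linear.linear[OF bounded_linear_scaleC], of \<i> c k] by simp
  then show "c *\<^sub>R k \<in> symplectic_complement H" using k by (simp add: symplectic_complement_def Im_cinner)
next
  have "\<i> *\<^sub>C (0::'a) = 0" using linear_0[OF bounded_linear.linear[OF bounded_linear_scaleC]] .
  then show "0 \<in> symplectic_complement H" by (simp add: symplectic_complement_def Im_cinner)
qed (simp add: symplectic_complement_def Im_cinner scaleC_add_right inner_add_left)

lemma closed_symplectic_complement: "closed (symplectic_complement H)"
proof -
  have "symplectic_complement H = (\<Inter>h\<in>H. {k. inner (\<i> *\<^sub>C k) h = 0})"
    by (auto simp: symplectic_complement_def Im_cinner)
  moreover have "closed {k. inner (\<i> *\<^sub>C k) h = 0}" for h :: 'a
    by (intro closed_Collect_eq continuous_intros linear_continuous_on bounded_linear_scaleC)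
  ultimately show ?thesis by (metis (no_types, lifting) closed_INT)
qed

lemma cutting_projection_iff:
  "(x, y) \<in> cutting_projection H \<longleftrightarrow> y \<in> H \<and> x - y \<in> symplectic_complement H"
proof
  assume "y \<in> H \<and> x - y \<in> symplectic_complement H"
  then have "(y + (x - y), y) \<in> cutting_projection H" unfolding cutting_projection_def by blast
  then show "(x, y) \<in> cutting_projection H" by simp
qed (auto simp: cutting_projection_def)

text \<open>Both conditions on (x, y) are preimages of closed real subspaces under continuous maps;
  the sum of the subspaces, which may fail to be closed, does not enter.\<close>

lemma closed_cutting_projection:
  assumes "closed H" shows "closed (cutting_projection H)"
proof -
  have "cutting_projection H = snd -` H \<inter> (\<lambda>p. fst p - snd p) -` symplectic_complement H"
    by (auto simp: cutting_projection_iff)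
  then show ?thesis
    using assms by (simp only:) (intro closed_Int closed_vimage continuous_intros closed_symplectic_complement)
qed

lemma cutting_projection_unique:
  assumes "subspace H" "factorial_subspace H" "(x, y) \<in> cutting_projection H" "(x, z) \<in> cutting_projection H"
  shows "y = z"
proof -
  have "y - z \<in> H" using assms by (auto simp: cutting_projection_iff subspace_diff)
  moreover have "(x - z) - (x - y) \<in> symplectic_complement H"
    by (rule subspace_diff[OF subspace_symplectic_complement])
      (use assms in \<open>auto simp: cutting_projection_iff\<close>)
  ultimately have "y - z \<in> H \<inter> symplectic_complement H" by simp
  then have "y - z \<in> {0}" using assms(2) unfolding factorial_subspace_def by blast
  then show ?thesis by simp
qed

section \<open>Modular theory of a factorial standard subspace\<close>

locale modular_theory =
  fixes H :: "'a::chilbert_space set" and \<Delta> :: "'a graph" and J :: "'a \<Rightarrow> 'a"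
    and E :: "real set \<Rightarrow> 'a \<Rightarrow> 'a"
  assumes standard: "standard_subspace H" and factorial: "factorial_subspace H"
    and modular: "modular_objects H \<Delta> J E"

sublocale modular_theory \<subseteq> pvm E
  using modular by unfold_locales (simp add: modular_objects_def spectral_measure_of_def)

context modular_theory
begin

lemma \<Delta>_eq: "\<Delta> = Sp (\<lambda>t. t)"
  using modular by (simp add: modular_objects_def spectral_measure_of_def)

lemma J_involution: "antiunitary_involution J"
  using modular by (simp add: modular_objects_def)

lemma J_add: "J (x + y) = J x + J y"
  and J_scaleC: "J (c *\<^sub>C x) = cnj c *\<^sub>C J x"
  and J_J [simp]: "J (J x) = x"
  using J_involution by (auto simp: antiunitary_involution_def)

lemma J_inner_J: "inner (J x) (J y) = inner x y"
proof -
  have "inner (J x) (J y) = inner y x"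
    using J_involution by (simp add: antiunitary_involution_def inner_eq_Re_cinner)
  then show ?thesis by (simp add: inner_commute)
qed

lemma J_inner: "inner (J x) y = inner x (J y)"
  by (metis J_J J_inner_J)

lemma bounded_linear_J: "bounded_linear J"
proof (rule bounded_linear_intro[where K = 1])
  show "norm (J x) \<le> norm x * 1" for x by (simp add: norm_eq_sqrt_inner J_inner_J)
qed (simp_all add: J_add J_scaleC scaleR_scaleC)

lemma norm_J: "norm (J x) = norm x"
  by (simp add: norm_eq_sqrt_inner J_inner_J)

lemma J_diff: "J (x - y) = J x - J y"
  using bounded_linear_J by (metis bounded_linear.linear linear_diff)

lemma J_i: "J (\<i> *\<^sub>C x) = - (\<i> *\<^sub>C J x)"
proof -
  have "J (\<i> *\<^sub>C x) = (-1 * \<i>) *\<^sub>C J x" by (simp add: J_scaleC)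
  also have "\<dots> = - (\<i> *\<^sub>C J x)"
    using scaleR_scaleC[of "-1" "\<i> *\<^sub>C J x"] by (simp add: scaleC_scaleC)
  finally show ?thesis .
qed

section \<open>The square root of the modular operator and the Tomita operator\<close>

abbreviation T :: "'a graph" where "T \<equiv> Sp (\<lambda>t. t powr (1/2))"

lemma tomita_iff: "(x, y) \<in> tomita_op H \<longleftrightarrow> (x, J y) \<in> T"
proof -
  have "tomita_op H = graph_of J \<odot> T"
    using modular by (simp add: modular_objects_def)
  then show ?thesis by (auto simp: op_comp_iff graph_of_iff)
qed

text \<open>Changing the sign of \<open>k\<close> exchanges the two components of a pair.\<close>

lemma tomita_sym: assumes "(x, y) \<in> tomita_op H" shows "(y, x) \<in> tomita_op H"
proof -
  obtain h k where hk: "x = h + \<i> *\<^sub>C k" "y = h - \<i> *\<^sub>C k" "h \<in> H" "k \<in> H"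
    using assms by (auto simp: tomita_op_def)
  have "- k \<in> H" using hk standard by (simp add: standard_subspace_def subspace_neg)
  moreover have "y = h + \<i> *\<^sub>C (- k)" "x = h - \<i> *\<^sub>C (- k)" using hk by (simp_all add: scaleC_minus_right)
  ultimately show ?thesis using hk(3) unfolding tomita_op_def by blast
qed

text \<open>The graph form of J T J = T^(-1): T x = y becomes T (J y) = J x.\<close>

lemma T_flip: assumes "(x, y) \<in> T" shows "(J y, J x) \<in> T"
  using tomita_sym[of x "J y"] assms by (simp add: tomita_iff)

text \<open>H is the fixed-point set of the Tomita operator S = J T. For the converse, S h = h gives
  h = g + i k = g - i k, which forces i k = 0.\<close>

lemma H_iff: "h \<in> H \<longleftrightarrow> (h, J h) \<in> T"
proof
  assume "h \<in> H"
  have "0 \<in> H" using standard by (simp add: standard_subspace_def subspace_0)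
  moreover have "\<i> *\<^sub>C (0::'a) = 0" using linear_0[OF bounded_linear.linear[OF bounded_linear_scaleC]] .
  ultimately have "(h, h) \<in> tomita_op H"
    unfolding tomita_op_def using \<open>h \<in> H\<close> by force
  then show "(h, J h) \<in> T" by (simp add: tomita_iff)
next
  assume "(h, J h) \<in> T"
  then have "(h, h) \<in> tomita_op H" by (simp add: tomita_iff)
  then obtain g k where gk: "h = g + \<i> *\<^sub>C k" "h = g - \<i> *\<^sub>C k" "g \<in> H"
    unfolding tomita_op_def by blast
  have "2 *\<^sub>R (\<i> *\<^sub>C k) = (g + \<i> *\<^sub>C k) - (g - \<i> *\<^sub>C k)" by (simp add: scaleR_2)
  also have "\<dots> = 0" using gk(1,2) by (metis diff_self)
  finally show "h \<in> H" using gk by simp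
qed

text \<open>Adding the pair to its flip gives (u + J c, c + J u), which has the form (h, J
  h).\<close>

lemma T_H: assumes "(u, c) \<in> T" shows "u + J c \<in> H"
  using Sp_add_vec[OF _ assms T_flip[OF assms]] by (simp add: H_iff J_add add.commute)

text \<open>Symmetry of \<open>T\<close> turns the term with \<open>c\<close> into the real inner
  product of i u and J h; antilinearity of \<open>J\<close> turns the term with \<open>J u\<close>
  into its negative.\<close>

lemma T_symplectic_complement: assumes "(u, c) \<in> T" shows "c + J u \<in> symplectic_complement H"
  unfolding symplectic_complement_def Im_cinner
proof (intro CollectI ballI)
  fix h assume "h \<in> H"
  then have h: "(h, J h) \<in> T" by (simp add: H_iff)
  have "inner (\<i> *\<^sub>C J u) h = - inner (\<i> *\<^sub>C u) (J h)"
    using J_inner[of "\<i> *\<^sub>C u" h] by (simp add: J_i)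
  also have "inner (\<i> *\<^sub>C u) (J h) = inner (\<i> *\<^sub>C c) h"
    using Sp_inner[OF _ Sp_scaleC_vec[OF _ assms] h, of \<i>] by simp
  finally show "inner (\<i> *\<^sub>C (c + J u)) h = 0" by (simp add: scaleC_add_right inner_add_left)
qed

section \<open>The spectral measure lives on (0, infinity) - {1}\<close>

lemma E_zero_point: "E {0} x = 0"
proof -
  obtain y where "(E {0} x, y) \<in> Sp (\<lambda>t. t)" "(norm y)\<^sup>2 \<le> 0 * (norm (E {0} x))\<^sup>2"
    by (rule Sp_bounded_on[of "\<lambda>t. t" "{0}" "E {0} x" 0]) (auto simp: E_idem)
  then show ?thesis
    using modular by (simp add: modular_objects_def nonsingular_def \<Delta>_eq[symmetric])
qed

text \<open>On [-n, 0) the square of R = sqrt |t| is minus the modular operator, so positivity makes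
  minus the squared norm of R y nonnegative. Hence R y = 0, the modular operator annihilates y, and
  nonsingularity gives y = 0. The truncation at -n makes R bounded.\<close>

lemma E_negative: "E {..<0} x = 0"
proof -
  have "E {- real n..<0} x = 0" for n
  proof -
    let ?B = "{- real n..<0}"
    define y where "y = E ?B x"
    have y: "E ?B y = y" by (simp add: y_def E_idem)
    have sq: "(sqrt \<bar>t\<bar>)\<^sup>2 \<le> real n" if "t \<in> ?B" for t using that by auto
    obtain w where w: "(y, w) \<in> Sp (\<lambda>t. sqrt \<bar>t\<bar>)" "E ?B w = w"
      by (rule Sp_bounded_on[OF _ _ y sq, of "\<lambda>t. t"]) auto
    obtain v where v: "(w, v) \<in> Sp (\<lambda>t. sqrt \<bar>t\<bar>)"
      by (rule Sp_bounded_on[OF _ _ w(2) sq, of "\<lambda>t. t"]) auto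
    have "(y, v) \<in> Sp (\<lambda>t. sqrt \<bar>t\<bar> * sqrt \<bar>t\<bar>)"
      using v Sp_comp[OF _ _ w(1), of "\<lambda>t. sqrt \<bar>t\<bar>" v] by simp
    then have "(y, v) \<in> Sp (\<lambda>t. - t)"
      by (subst Sp_cong[of ?B]) (auto simp: y)
    then have z: "(y, - v) \<in> \<Delta>"
      using Sp_simple_comp[of "\<lambda>t. - t" y v "\<lambda>t. -1"]
      by (simp add: \<Delta>_eq simple_integral_def E_UNIV vimage_def)
    then have "0 \<le> inner y (- v)"
      using modular by (auto simp: modular_objects_def positive_op_def inner_eq_Re_cinner)
    moreover have "inner w w = inner y v" using Sp_inner[OF _ w(1) v] by simp
    ultimately have "w = 0" by (metis inner_ge_zero inner_eq_zero_iff inner_minus_right neg_0_le_iff_le order_antisym)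
    then have "v = 0" using v Sp_norm[OF _ v] L2_le_const[of "{}" 0 "\<lambda>t. sqrt \<bar>t\<bar>" 0] by (simp add: E_empty)
    then show ?thesis
      using z modular by (simp add: modular_objects_def nonsingular_def y_def)
  qed
  then have "E (\<Union>n. {- real n..<0}) x = 0" by (intro E_UN_zero) auto
  moreover have "(\<Union>n. {- real n..<0}) = {..<0}"
    by (auto simp: minus_le_iff real_arch_simple)
  ultimately show ?thesis by simp
qed

lemma E_one: "E {1} x = 0"
proof -
  define y where "y = E {1} x"
  have T: "(u, u) \<in> T" if "E {1} u = u" for u
    using Sp_const[of u 1] that by (subst Sp_cong[of "{1}" _ _ "\<lambda>t. 1"]) auto
  have *: "u + J u = 0" if "E {1} u = u" for u
    using T_H[OF T[OF that]] T_symplectic_complement[OF T[OF that]] factorial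
    by (auto simp: factorial_subspace_def)
  have y: "E {1} y = y" by (simp add: y_def E_idem)
  have "J y = - y" using *[OF y] by (simp add: eq_neg_iff_add_eq_0 add.commute)
  \<comment> \<open>The range of \<open>E {1}\<close> is a complex subspace on which
    \<open>J\<close> acts as -1; antilinearity of \<open>J\<close> then leaves only the zero
    vector.\<close>
  moreover have "\<i> *\<^sub>C y + J (\<i> *\<^sub>C y) = 0" using y by (intro *) (simp add: E_scaleC)
  ultimately have "\<i> *\<^sub>C y + \<i> *\<^sub>C y = 0" by (simp add: J_i scaleC_minus_right)
  then have "norm (\<i> *\<^sub>C y) = 0" by (simp flip: scaleR_2)
  then show ?thesis by (simp add: norm_scaleC y_def)
qed

lemma E_pos: "E {0<..} x = x"
proof -
  have "{0<..} \<union> ({..<0} \<union> {0}) = (UNIV :: real set)" by auto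
  moreover have "E ({0<..} \<union> ({..<0} \<union> {0})) x = E {0<..} x + E ({..<0} \<union> {0}) x"
    by (rule E_Un) auto
  moreover have "E ({..<0} \<union> {0}) x = E {..<0} x + E {0} x"
    by (rule E_Un) auto
  ultimately show ?thesis by (simp add: E_zero_point E_negative E_UNIV)
qed

text \<open>Every vector is carried by the set where the identities for \<open>a_fun\<close> and
  \<open>b_fun\<close> hold, so \<open>Sp_cong\<close> applies to arbitrary vectors.\<close>

lemma E_regular: "E ({0<..} - {1}) x = x"
proof -
  have "({0<..} - {1}) \<union> {1} = {0::real<..}" by auto
  moreover have "E (({0<..} - {1}) \<union> {1}) x = E ({0<..} - {1}) x + E {1} x"
    by (rule E_Un) auto
  ultimately show ?thesis by (simp add: E_one E_pos)
qed

lemma E_split: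
  assumes "A \<in> sets borel" "B \<in> sets borel" "A \<inter> B = {}" "A \<union> B = {0<..}"
  shows "E A x = x - E B x"
  using E_Un[OF assms(1-3), of x] assms(4) by (simp add: E_pos) (metis add_diff_cancel_right')

text \<open>Since \<open>y\<close> stays in the range of \<open>E B\<close>, the step can be
  repeated. Each round costs the factor \<open>q\<close> for the passage from J x to J y and
  \<open>p\<close> for the passage from x to y.\<close>

lemma contraction_zero:
  assumes C: "C \<in> sets borel" and pq: "0 \<le> p" "0 \<le> q" "q * p < 1"
    and step: "\<And>x. E B x = x \<Longrightarrow> \<exists>y. E B y = y \<and> (norm y)\<^sup>2 \<le> p * (norm x)\<^sup>2
      \<and> (norm (E C (J x)))\<^sup>2 \<le> q * (norm (E C (J y)))\<^sup>2"
    and "E B x = x"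
  shows "E C (J x) = 0"
proof -
  have *: "(norm (E C (J x)))\<^sup>2 \<le> (q * p) ^ n * (norm x)\<^sup>2" if "E B x = x" for n x
    using that
  proof (induction n arbitrary: x)
    case 0
    show ?case using norm_E_le[OF C, of "J x"] by (simp add: norm_J)
  next
    case (Suc n)
    obtain y where y: "E B y = y" "(norm y)\<^sup>2 \<le> p * (norm x)\<^sup>2"
      "(norm (E C (J x)))\<^sup>2 \<le> q * (norm (E C (J y)))\<^sup>2"
      using step[OF Suc.prems] by blast
    have "q * (norm (E C (J y)))\<^sup>2 \<le> q * ((q * p) ^ n * (norm y)\<^sup>2)"
      by (intro mult_left_mono Suc.IH y pq)
    also have "\<dots> \<le> q * ((q * p) ^ n * (p * (norm x)\<^sup>2))"
      using pq by (intro mult_left_mono y) auto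
    also have "\<dots> = (q * p) ^ Suc n * (norm x)\<^sup>2" by simp
    finally show ?case using y(3) by linarith
  qed
  have "(\<lambda>n. (q * p) ^ n * (norm x)\<^sup>2) \<longlonglongrightarrow> 0 * (norm x)\<^sup>2"
    using pq by (intro tendsto_intros LIMSEQ_power_zero) auto
  then have "(norm (E C (J x)))\<^sup>2 \<le> 0 * (norm x)\<^sup>2"
    using * assms(6) by (intro LIMSEQ_le_const) auto
  then show ?thesis by simp
qed

section \<open>The modular conjugation inverts the spectrum\<close>

lemma J_small_small:
  assumes "0 < c" "0 < d" "d * c < 1"
  shows "E {0<..d} (J (E {0<..c} x)) = 0"
proof (rule contraction_zero[where B = "{0<..c}" and p = c and q = d])
  fix x assume x: "E {0<..c} x = x"
  obtain y where y: "(x, y) \<in> T" "(norm y)\<^sup>2 \<le> c * (norm x)\<^sup>2" "E {0<..c} y = y"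
    by (rule Sp_bounded_on[OF _ _ x, of "\<lambda>t. t powr (1/2)" c]) (use assms in \<open>auto simp: powr_half_power2\<close>)
  have "(E {0<..d} (J y), E {0<..d} (J x)) \<in> T"
    by (intro E_Sp T_flip y) auto
  then obtain z where "(E {0<..d} (J y), z) \<in> T" "(norm z)\<^sup>2 \<le> d * (norm (E {0<..d} (J y)))\<^sup>2"
    using Sp_bounded_on[of "\<lambda>t. t powr (1/2)" "{0<..d}" "E {0<..d} (J y)" d] assms
    by (auto simp: powr_half_power2 E_idem)
  moreover have "z = E {0<..d} (J x)"
    using Sp_unique[OF _ \<open>(E {0<..d} (J y), z) \<in> T\<close> \<open>(E {0<..d} (J y), E {0<..d} (J x)) \<in> T\<close>] by simp
  ultimately show "\<exists>y. E {0<..c} y = y \<and> (norm y)\<^sup>2 \<le> c * (norm x)\<^sup>2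
      \<and> (norm (E {0<..d} (J x)))\<^sup>2 \<le> d * (norm (E {0<..d} (J y)))\<^sup>2"
    using y by blast
qed (use assms in \<open>auto simp: E_idem\<close>)

text \<open>Here y = T^(-1) x, which is bounded on [c, infinity). Flipping T y = x gives T (J x) = J
  y, and the lower bound of T on [d, infinity) yields the factor 1/d.\<close>

lemma J_large_large:
  assumes "0 < c" "0 < d" "1 < d * c"
  shows "E {d..} (J (E {c..} x)) = 0"
proof (rule contraction_zero[where B = "{c..}" and p = "inverse c" and q = "inverse d"])
  fix x assume x: "E {c..} x = x"
  have le: "(t powr (-1/2))\<^sup>2 \<le> inverse c" if "t \<in> {c..}" for t
    unfolding powr_minus_half using that assms by (simp add: power_inverse powr_half_power2 le_imp_inverse_le)
  obtain y where y: "(x, y) \<in> Sp (\<lambda>t. t powr (-1/2))" "(norm y)\<^sup>2 \<le> inverse c * (norm x)\<^sup>2" "E {c..} y = y"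
    by (rule Sp_bounded_on[OF _ _ x le]) (use assms in auto)
  have "(x, x) \<in> Sp (\<lambda>t. t powr (1/2) * t powr (-1/2))"
    using Sp_const[of x 1] E_pos by (subst Sp_cong[of "{0<..}" _ _ "\<lambda>t. 1"]) (auto simp flip: powr_add)
  then have "(y, x) \<in> T" using Sp_comp[OF _ _ y(1), of "\<lambda>t. t powr (1/2)" x] by simp
  then have "(E {d..} (J x), E {d..} (J y)) \<in> T" by (intro E_Sp T_flip) auto
  then have "d * (norm (E {d..} (J x)))\<^sup>2 \<le> (norm (E {d..} (J y)))\<^sup>2"
    using assms by (intro Sp_bounded_below_on[of "\<lambda>t. t powr (1/2)" "{d..}"]) (auto simp: E_idem powr_half_power2)
  then have "(norm (E {d..} (J x)))\<^sup>2 \<le> inverse d * (norm (E {d..} (J y)))\<^sup>2"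
    using assms by (simp add: field_simps)
  then show "\<exists>y. E {c..} y = y \<and> (norm y)\<^sup>2 \<le> inverse c * (norm x)\<^sup>2
      \<and> (norm (E {d..} (J x)))\<^sup>2 \<le> inverse d * (norm (E {d..} (J y)))\<^sup>2"
    using y by blast
qed (use assms in \<open>auto simp: E_idem field_simps\<close>)

lemma ex_inverse_Suc_less: "0 < (x::real) \<Longrightarrow> \<exists>n. inverse (real (Suc n)) < x"
  using reals_Archimedean by blast

lemma J_small_strict: assumes "0 < c"
  shows "E {0<..<inverse c} (J (E {0<..c} x)) = 0"
proof -
  \<comment> \<open>The contraction needs a product strictly below 1, so the threshold 1/c is only
    approached from below, and the interval obtained is open there.\<close>
  let ?d = "\<lambda>n. inverse (c + inverse (real (Suc n)))"
  have "E {0<..?d n} (J (E {0<..c} x)) = 0" for n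
  proof -
    define e where "e = inverse (real (Suc n))"
    have "0 < e" by (simp add: e_def)
    then have "0 < inverse (c + e)" "inverse (c + e) * c < 1" using assms by (auto simp: field_simps)
    then show ?thesis unfolding e_def[symmetric] using assms by (intro J_small_small)
  qed
  then have "E (\<Union>n. {0<..?d n}) (J (E {0<..c} x)) = 0" by (intro E_UN_zero) auto
  moreover have "(\<Union>n. {0<..?d n}) = {0<..<inverse c}"
  proof (intro equalityI subsetI)
    fix t assume "t \<in> (\<Union>n. {0<..?d n})"
    then obtain n where n: "0 < t" "t \<le> ?d n" by auto
    have "?d n < inverse c" using assms by (intro less_imp_inverse_less) auto
    then show "t \<in> {0<..<inverse c}" using n by simp
  next
    fix t assume "t \<in> {0<..<inverse c}"
    then have t: "0 < t" "c < inverse t" using assms less_imp_inverse_less[of t "inverse c"] by auto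
    obtain n where "inverse (real (Suc n)) < inverse t - c"
      using ex_inverse_Suc_less[of "inverse t - c"] t by auto
    then have "c + inverse (real (Suc n)) \<le> inverse t" by simp
    then have "inverse (inverse t) \<le> ?d n" using assms by (intro le_imp_inverse_le) (auto intro: add_pos_pos)
    then show "t \<in> (\<Union>n. {0<..?d n})" using t by auto
  qed
  ultimately show ?thesis by simp
qed

lemma J_large_strict: assumes "0 < c"
  shows "E {inverse c<..} (J (E {c..} x)) = 0"
proof -
  let ?d = "\<lambda>n. inverse c + inverse (real (Suc n))"
  have "E {?d n..} (J (E {c..} x)) = 0" for n
  proof -
    have "0 < inverse (real (Suc n))" by simp
    then show ?thesis using assms by (intro J_large_large) (auto simp: distrib_right intro: add_pos_pos)
  qed
  then have "E (\<Union>n. {?d n..}) (J (E {c..} x)) = 0" by (intro E_UN_zero) auto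
  moreover have "(\<Union>n. {?d n..}) = {inverse c<..}"
  proof (intro equalityI subsetI)
    fix t assume "t \<in> (\<Union>n. {?d n..})"
    then obtain n where "?d n \<le> t" by auto
    moreover have "0 < inverse (real (Suc n))" by simp
    ultimately have "inverse c < t" by linarith
    then show "t \<in> {inverse c<..}" by simp
  next
    fix t assume "t \<in> {inverse c<..}"
    then obtain n where "inverse (real (Suc n)) < t - inverse c"
      using ex_inverse_Suc_less[of "t - inverse c"] by auto
    then have "?d n \<le> t" by linarith
    then show "t \<in> (\<Union>n. {?d n..})" by blast
  qed
  ultimately show ?thesis by simp
qed

text \<open>Taking real adjoints interchanges the two projections. This moves the closed endpoint to
  the other side, as is needed for the exact complement of (0, c].\<close>

lemma J_large_strict': assumes "0 < c"
  shows "E {inverse c..} (J (E {c<..} x)) = 0"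
proof -
  have "inner (E {inverse c..} (J (E {c<..} x))) v = 0" for v
    using J_large_strict[of "inverse c" v] assms by (simp add: E_inner J_inner)
  then show ?thesis using inner_eq_zero_iff by blast
qed

text \<open>\<open>J\<close> sends the range of \<open>E {0<..c}\<close> into that of
  \<open>E {inverse c..}\<close>, and the complementary part into its kernel. Applying the latter
  projection to J x therefore picks out the first part.\<close>

lemma J_E_le: assumes "0 < c" shows "J (E {0<..c} x) = E {inverse c..} (J x)"
proof -
  let ?w = "J (E {0<..c} x)"
  have "E {inverse c..} ?w = ?w - E {0<..<inverse c} ?w"
    using assms positive_imp_inverse_positive[OF assms] by (intro E_split) (auto simp del: inverse_positive_iff_positive)
  then have "E {inverse c..} ?w = ?w" by (simp add: J_small_strict assms)
  moreover have "E {c<..} x = x - E {0<..c} x" using assms by (intro E_split) auto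
  then have "E {inverse c..} (J x - ?w) = 0"
    using J_large_strict'[OF assms, of x] by (simp add: J_diff)
  ultimately show ?thesis by (simp add: E_diff)
qed

lemma J_E_greater: assumes "0 < c" shows "J (E {c<..} x) = E {0<..<inverse c} (J x)"
proof -
  have "E {c<..} x = x - E {0<..c} x" using assms by (intro E_split) auto
  moreover have "E {0<..<inverse c} (J x) = J x - E {inverse c..} (J x)"
    using positive_imp_inverse_positive[OF assms] by (intro E_split) (auto simp del: inverse_positive_iff_positive)
  ultimately show ?thesis by (simp add: J_diff J_E_le assms)
qed

text \<open>Obtained from \<open>J_E_greater\<close> at 1/c and J x by applying \<open>J\<close> to
  both sides.\<close>

lemma J_E_less: assumes "0 < c" shows "J (E {0<..<c} x) = E {inverse c<..} (J x)"
  using J_E_greater[of "inverse c" "J x"] assms by (metis J_J inverse_inverse_eq positive_imp_inverse_positive)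

lemma J_E_interval:
  assumes "0 < a" "0 < b" shows "J (E {a<..<b} x) = E {inverse b<..<inverse a} (J x)"
proof -
  have "{a<..<b} = {a<..} \<inter> {0<..<b}" using assms by auto
  then have "J (E {a<..<b} x) = E {0<..<inverse a} (E {inverse b<..} (J x))"
    using assms by (simp add: E_Int J_E_greater J_E_less)
  also have "\<dots> = E ({0<..<inverse a} \<inter> {inverse b<..}) (J x)" by (simp add: E_Int)
  also have "{0<..<inverse a} \<inter> {inverse b<..} = {inverse b<..<inverse a}"
    using positive_imp_inverse_positive[OF assms(2)] by (auto simp del: inverse_positive_iff_positive)
  finally show ?thesis .
qed

section \<open>The cutting projection as a function of the modular operator\<close>

lemma Sp_a_b_cutting:
  assumes u: "(x, u) \<in> Sp a_fun" and w: "(x, w) \<in> Sp b_fun"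
  shows "(x, u + J w) \<in> cutting_projection H"
proof -
  have "(x, w) \<in> Sp (\<lambda>t. t powr (1/2) * a_fun t)"
    using w by (subst Sp_cong[OF _ E_regular, of _ b_fun]) (auto simp: sqrt_a_fun)
  then have uw: "(u, w) \<in> T" using Sp_comp[OF _ _ u, of "\<lambda>t. t powr (1/2)" w] by simp
  have "(x, u - x) \<in> Sp (\<lambda>t. a_fun t - 1)"
    using Sp_diff[OF _ _ u Sp_const[of x 1]] by simp
  then have "(x, u - x) \<in> Sp (\<lambda>t. t powr (1/2) * b_fun t)"
    by (subst Sp_cong[OF _ E_regular, of _ "\<lambda>t. a_fun t - 1"]) (auto simp: sqrt_b_fun)
  then have "(w, u - x) \<in> T" using Sp_comp[OF _ _ w, of "\<lambda>t. t powr (1/2)" "u - x"] by simp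
  then have "- ((u - x) + J w) \<in> symplectic_complement H"
    by (intro subspace_neg subspace_symplectic_complement T_symplectic_complement)
  also have "- ((u - x) + J w) = x - (u + J w)" by simp
  finally show ?thesis using T_H[OF uw] by (simp add: cutting_projection_iff)
qed

lemma Domain_cutting_projection:
  "Domain (cutting_projection H) = {h + h' | h h'. h \<in> H \<and> h' \<in> symplectic_complement H}"
  by (auto simp: cutting_projection_def)

lemma Domain_a_b_subset: "Domain (Sp a_fun) \<inter> Domain (Sp b_fun) \<subseteq> Domain (cutting_projection H)"
  using Sp_a_b_cutting by blast

lemma cutting_single_valued:
  "(x, y) \<in> cutting_projection H \<Longrightarrow> (x, z) \<in> cutting_projection H \<Longrightarrow> y = z"
  using cutting_projection_unique standard factorial unfolding standard_subspace_def by blast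

text \<open>\<open>Sp_a_b_cutting\<close> only exhibits one value in the graph; single-valuedness,
  which rests on factoriality, makes it the only one.\<close>

lemma op_restrict_cutting:
  "op_restrict (cutting_projection H) (Domain (Sp a_fun) \<inter> Domain (Sp b_fun))
    = Sp a_fun \<boxplus> (graph_of J \<odot> Sp b_fun)" (is "?L = ?R")
proof (intro equalityI subrelI)
  fix x y assume "(x, y) \<in> ?L"
  then obtain u w where uw: "(x, u) \<in> Sp a_fun" "(x, w) \<in> Sp b_fun" and y: "(x, y) \<in> cutting_projection H"
    by (auto simp: op_restrict_def)
  have "y = u + J w" using y Sp_a_b_cutting[OF uw] by (rule cutting_single_valued)
  moreover have "(x, J w) \<in> graph_of J \<odot> Sp b_fun" using uw by (auto simp: op_comp_iff graph_of_iff)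
  ultimately show "(x, y) \<in> ?R" using uw unfolding op_plus_def by blast
next
  fix x y assume "(x, y) \<in> ?R"
  then obtain u v where uv: "(x, u) \<in> Sp a_fun" "(x, v) \<in> graph_of J \<odot> Sp b_fun" "y = u + v"
    unfolding op_plus_def by blast
  then obtain w where w: "(x, w) \<in> Sp b_fun" "v = J w" by (auto simp: op_comp_iff graph_of_iff)
  show "(x, y) \<in> ?L" using Sp_a_b_cutting[OF uv(1) w(1)] uv w by (auto simp: op_restrict_def)
qed

section \<open>The formula with the inverse of a difference\<close>

text \<open>Excludes that cancellation enlarges the domain of the difference. For r = t^(1/2)
  nonzero, 2 (1/r - r)^2 + 2 = 1/r^2 + (1/r - r)^2 + r^2, because the cross term of 1/r and r is
  constant.\<close>

lemma L2_minus_half: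
  assumes "L2 x (\<lambda>t. t powr (-1/2) - t powr (1/2)) < \<infinity>"
  shows "L2 x (\<lambda>t. t powr (-1/2)) < \<infinity>"
proof -
  have "L2 x (\<lambda>t. t powr (-1/2)) \<le> 2 * L2 x (\<lambda>t. t powr (-1/2) - t powr (1/2)) + 2 * L2 x (\<lambda>t. 1)"
  proof (rule L2_le_two)
    fix t :: real
    define r where "r = t powr (1/2)"
    have "(inverse r)\<^sup>2 \<le> 2 * (inverse r - r)\<^sup>2 + 2 * 1\<^sup>2"
    proof (cases "r = 0")
      case False
      then have "2 * (inverse r - r)\<^sup>2 + 2 = (inverse r)\<^sup>2 + (inverse r - r)\<^sup>2 + r\<^sup>2"
        by (simp add: power2_diff)
      then show ?thesis using zero_le_power2[of r] zero_le_power2[of "inverse r - r"]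
        unfolding one_power2 by linarith
    qed simp
    then show "(t powr (-1/2))\<^sup>2 \<le> 2 * (t powr (-1/2) - t powr (1/2))\<^sup>2 + 2 * 1\<^sup>2"
      unfolding powr_minus_half r_def .
  qed auto
  also have "\<dots> < \<infinity>"
    using assms Sp_const[of x 1] by (simp add: Sp_iff ennreal_mult_less_top)
  finally show ?thesis .
qed

lemma Sp_minus_half_diff:
  "Sp (\<lambda>t. t powr (-1/2)) \<boxminus> T = Sp (\<lambda>t. t powr (-1/2) - t powr (1/2))" (is "?L = Sp ?f")
proof (intro equalityI subrelI)
  fix x y assume "(x, y) \<in> ?L"
  then show "(x, y) \<in> Sp ?f" unfolding op_minus_def by (auto intro!: Sp_diff)
next
  fix x y assume xy: "(x, y) \<in> Sp ?f"
  then have "L2 x (\<lambda>t. t powr (-1/2)) < \<infinity>" by (intro L2_minus_half) (simp add: Sp_iff)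
  then obtain u where u: "(x, u) \<in> Sp (\<lambda>t. t powr (-1/2))"
    using Sp_ex measurable_powers(2) by blast
  have "(x, u - y) \<in> T" using Sp_diff[OF _ _ u xy] by simp
  moreover have "y = u - (u - y)" by simp
  ultimately show "(x, y) \<in> ?L" using u unfolding op_minus_def by blast
qed

text \<open>On the set carrying every vector the product of \<open>f\<close> and its pointwise
  inverse is 1, so the product rule read in both directions gives equality of graphs, domains
  included.\<close>

lemma inverse_Sp:
  assumes [measurable]: "f \<in> borel_measurable borel" and "\<And>t. 0 < t \<Longrightarrow> t \<noteq> 1 \<Longrightarrow> f t \<noteq> 0"
  shows "(Sp f)\<inverse> = Sp (\<lambda>t. inverse (f t))"
proof -
  have id: "(x, x) \<in> Sp (\<lambda>t. f t * inverse (f t))" "(x, x) \<in> Sp (\<lambda>t. inverse (f t) * f t)" for x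
    using Sp_const[of x 1] assms(2)
    by (subst Sp_cong[OF _ E_regular, of _ "\<lambda>t. 1"]; simp)+
  show ?thesis
  proof (intro equalityI subrelI)
    fix y x assume "(y, x) \<in> (Sp f)\<inverse>"
    then show "(y, x) \<in> Sp (\<lambda>t. inverse (f t))"
      using Sp_comp[of f "\<lambda>t. inverse (f t)" x y x] id(2) by simp
  next
    fix y x assume "(y, x) \<in> Sp (\<lambda>t. inverse (f t))"
    then show "(y, x) \<in> (Sp f)\<inverse>"
      using Sp_comp[of "\<lambda>t. inverse (f t)" f y x y] id(1) by simp
  qed
qed

lemma inverse_minus_half_diff: "(Sp (\<lambda>t. t powr (-1/2)) \<boxminus> T)\<inverse> = Sp b_fun"
  unfolding Sp_minus_half_diff
  using inverse_Sp[of "\<lambda>t. t powr (-1/2) - t powr (1/2)"] sqrt_neq_one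
  by (simp only: b_fun_def[abs_def] powr_minus_half) simp

text \<open>The composition has membership in the domain of \<open>Sp b_fun\<close> built in, while
  \<open>Sp a_fun\<close> does not; the common summand with \<open>J\<close> imposes it on both
  sides.\<close>

lemma minus_half_comp_b:
  "(Sp (\<lambda>t. t powr (-1/2)) \<odot> Sp b_fun) \<boxplus> (graph_of J \<odot> Sp b_fun) = Sp a_fun \<boxplus> (graph_of J \<odot> Sp b_fun)"
proof -
  have "(x, y) \<in> Sp (\<lambda>t. t powr (-1/2)) \<odot> Sp b_fun \<longleftrightarrow> (x, y) \<in> Sp a_fun" if "(x, w) \<in> Sp b_fun" for x y w
  proof -
    have "(x, y) \<in> Sp (\<lambda>t. t powr (-1/2)) \<odot> Sp b_fun \<longleftrightarrow> (w, y) \<in> Sp (\<lambda>t. t powr (-1/2))"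
      unfolding op_comp_iff using that Sp_unique[OF measurable_powers(4)] by metis
    also have "\<dots> \<longleftrightarrow> (x, y) \<in> Sp (\<lambda>t. t powr (-1/2) * b_fun t)"
      by (rule Sp_comp[OF _ _ that]) auto
    also have "(\<lambda>t. t powr (-1/2) * b_fun t) = a_fun"
      by (simp add: a_fun_def b_fun_def fun_eq_iff)
    finally show ?thesis .
  qed
  then have "(x, y) \<in> Sp (\<lambda>t. t powr (-1/2)) \<odot> Sp b_fun \<longleftrightarrow> (x, y) \<in> Sp a_fun"
    if "(x, v) \<in> graph_of J \<odot> Sp b_fun" for x y v
    using that by (auto simp only: op_comp_iff[of _ _ "graph_of J"])
  then show ?thesis unfolding op_plus_def by blast
qed

section \<open>Cores\<close>

abbreviation window :: "real \<Rightarrow> real set"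
  where "window \<epsilon> \<equiv> {\<epsilon><..<1 - \<epsilon>} \<union> {inverse (1 - \<epsilon>)<..<inverse \<epsilon>}"

lemma J_window:
  assumes "0 < \<epsilon>" "\<epsilon> < 1/2" shows "J (E (window \<epsilon>) x) = E (window \<epsilon>) (J x)"
proof -
  have "1 < inverse (1 - \<epsilon>)" using assms by (intro one_less_inverse) auto
  then have "{\<epsilon><..<1 - \<epsilon>} \<inter> {inverse (1 - \<epsilon>)<..<inverse \<epsilon>} = {}" using assms by auto
  \<comment> \<open>Inversion exchanges the two intervals, so after this splitting \<open>J\<close>
    merely permutes the summands.\<close>
  then have Un: "E (window \<epsilon>) z = E {\<epsilon><..<1 - \<epsilon>} z + E {inverse (1 - \<epsilon>)<..<inverse \<epsilon>} z" for z
    by (intro E_Un) auto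
  show ?thesis unfolding Un using assms by (simp add: J_add J_E_interval add.commute)
qed

text \<open>Both intervals keep distance at least \<epsilon> from 1, since 1/(1 - \<epsilon>) > 1 +
  \<epsilon>; this bounds 1/|1 - t|. The bound for \<open>b_fun\<close> follows because its square
  is t times that of \<open>a_fun\<close>, with t < 1/\<epsilon>.\<close>

lemma window_bounds:
  assumes "0 < \<epsilon>" "\<epsilon> < 1/2" "t \<in> window \<epsilon>"
  shows "0 < t" "t \<noteq> 1" "(a_fun t)\<^sup>2 \<le> (inverse \<epsilon>)\<^sup>2" "(b_fun t)\<^sup>2 \<le> inverse \<epsilon> * (inverse \<epsilon>)\<^sup>2"
proof -
  have inv: "1 + \<epsilon> < inverse (1 - \<epsilon>)"
  proof -
    have "(1 + \<epsilon>) * (1 - \<epsilon>) < 1" using assms by (simp add: algebra_simps)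
    then show ?thesis using assms by (simp add: field_simps)
  qed
  have le: "1 - \<epsilon> < inverse \<epsilon>" using assms one_less_inverse[of \<epsilon>] by linarith
  show t: "0 < t" using assms inv by auto
  have far: "\<epsilon> \<le> \<bar>1 - t\<bar>" using assms inv by auto
  then show "t \<noteq> 1" using assms by auto
  then have a: "\<bar>a_fun t\<bar> = inverse \<bar>1 - t\<bar>" using t by (simp add: a_fun_eq inverse_eq_divide)
  have "\<bar>a_fun t\<bar> \<le> \<bar>inverse \<epsilon>\<bar>"
    unfolding a using far assms by (simp add: le_imp_inverse_le)
  then show a2: "(a_fun t)\<^sup>2 \<le> (inverse \<epsilon>)\<^sup>2" by (simp only: abs_le_square_iff)
  have "(b_fun t)\<^sup>2 = t * (a_fun t)\<^sup>2"
    using t by (simp add: sqrt_a_fun[symmetric] power_mult_distrib powr_half_power2)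
  also have "\<dots> \<le> inverse \<epsilon> * (inverse \<epsilon>)\<^sup>2"
    using t a2 assms le by (intro mult_mono) auto
  finally show "(b_fun t)\<^sup>2 \<le> inverse \<epsilon> * (inverse \<epsilon>)\<^sup>2" .
qed

lemma window_Domain:
  assumes "0 < \<epsilon>" "\<epsilon> < 1/2" "E (window \<epsilon>) x = x"
  shows "x \<in> Domain (Sp a_fun) \<inter> Domain (Sp b_fun)"
proof -
  have C: "0 \<le> (inverse \<epsilon>)\<^sup>2" "0 \<le> inverse \<epsilon> * (inverse \<epsilon>)\<^sup>2" using assms by auto
  have W: "window \<epsilon> \<in> sets borel" by simp
  obtain u where "(x, u) \<in> Sp a_fun"
    by (rule Sp_bounded_on[OF measurable_powers(3) W assms(3) window_bounds(3)[OF assms(1,2)] C(1)])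
  moreover obtain w where "(x, w) \<in> Sp b_fun"
    by (rule Sp_bounded_on[OF measurable_powers(4) W assms(3) window_bounds(4)[OF assms(1,2)] C(2)])
  ultimately show ?thesis by blast
qed

lemma window_mono: assumes "0 < \<delta>" "\<delta> \<le> \<epsilon>" "\<epsilon> < 1/2" shows "window \<epsilon> \<subseteq> window \<delta>"
proof -
  have "inverse (1 - \<delta>) \<le> inverse (1 - \<epsilon>)" "inverse \<epsilon> \<le> inverse \<delta>"
    using assms by (auto intro: le_imp_inverse_le)
  then show ?thesis
    using assms by (intro Un_mono subsetI; simp only: greaterThanLessThan_iff; linarith)
qed

lemma E_window_mono:
  assumes "0 < \<delta>" "\<delta> \<le> \<epsilon>" "\<epsilon> < 1/2" "E (window \<epsilon>) x = x" shows "E (window \<delta>) x = x"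
  using E_Int[of "window \<delta>" "window \<epsilon>" x] assms(4) window_mono[OF assms(1-3)]
  by (simp add: Int_absorb1)

abbreviation D0 :: "'a set" where "D0 \<equiv> (\<Union>\<epsilon>\<in>{0<..<1/2}. range (E (window \<epsilon>)))"

lemma D0_iff: "x \<in> D0 \<longleftrightarrow> (\<exists>\<epsilon>. 0 < \<epsilon> \<and> \<epsilon> < 1/2 \<and> E (window \<epsilon>) x = x)"
proof
  assume "x \<in> D0"
  then obtain \<epsilon> y where "0 < \<epsilon>" "\<epsilon> < 1/2" "x = E (window \<epsilon>) y" by auto
  then show "\<exists>\<epsilon>. 0 < \<epsilon> \<and> \<epsilon> < 1/2 \<and> E (window \<epsilon>) x = x"
    by (intro exI[of _ \<epsilon>]) (simp add: E_idem)
next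
  assume "\<exists>\<epsilon>. 0 < \<epsilon> \<and> \<epsilon> < 1/2 \<and> E (window \<epsilon>) x = x"
  then obtain \<epsilon> where "\<epsilon> \<in> {0<..<1/2}" "E (window \<epsilon>) x = x" by auto
  then show "x \<in> D0"
    using rangeI[of "E (window \<epsilon>)" x] by (intro UN_I[of \<epsilon>]) simp_all
qed

lemma subspace_D0: "subspace D0"
proof (rule subspaceI)
  show "0 \<in> D0" unfolding D0_iff by (intro exI[of _ "1/4"]) (simp add: E_zero)
  show "c *\<^sub>R x \<in> D0" if "x \<in> D0" for c x
  proof -
    obtain \<epsilon> where "0 < \<epsilon>" "\<epsilon> < 1/2" "E (window \<epsilon>) x = x" using \<open>x \<in> D0\<close> unfolding D0_iff by blast
    then show ?thesis unfolding D0_iff by (intro exI[of _ \<epsilon>]) (simp add: E_scaleR)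
  qed
  show "x + y \<in> D0" if xy: "x \<in> D0" "y \<in> D0" for x y
  proof -
    obtain \<delta> \<epsilon> where d: "0 < \<delta>" "\<delta> < 1/2" "E (window \<delta>) x = x" and e: "0 < \<epsilon>" "\<epsilon> < 1/2" "E (window \<epsilon>) y = y"
      using xy unfolding D0_iff by blast
    \<comment> \<open>Windows grow as the parameter decreases, so the smaller parameter serves both
      vectors.\<close>
    let ?m = "min \<delta> \<epsilon>"
    have "E (window ?m) x = x" "E (window ?m) y = y"
      using E_window_mono[OF _ _ d(2,3), of ?m] E_window_mono[OF _ _ e(2,3), of ?m] d e by auto
    then have "E (window ?m) (x + y) = x + y" by (simp add: E_add)
    then show ?thesis unfolding D0_iff using d e by (intro exI[of _ ?m]) auto
  qed
qed

lemma E_window_tendsto: "(\<lambda>n. E (window (inverse (real (Suc (n + 2))))) x) \<longlonglongrightarrow> x"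
proof (rule E_tendsto)
  \<comment> \<open>The shift by 2 makes every parameter at most 1/3, hence admissible.\<close>
  let ?e = "\<lambda>n. inverse (real (Suc (n + 2)))"
  have e: "0 < ?e n" "?e n < 1/2" for n
    using less_imp_inverse_less[of 2 "real (Suc (n + 2))"] by auto
  show "incseq (\<lambda>n. window (?e n))"
    unfolding incseq_def using e by (intro allI impI window_mono le_imp_inverse_le) auto
  have "(\<Union>n. window (?e n)) = {0<..} - {1}"
  proof (intro equalityI subsetI)
    fix t assume "t \<in> (\<Union>n. window (?e n))"
    then show "t \<in> {0<..} - {1}" using window_bounds(1,2)[OF e] by blast
  next
    fix t :: real assume t: "t \<in> {0<..} - {1}"
    \<comment> \<open>A parameter below \<open>d\<close> puts \<open>t\<close> in the left interval
      if t < 1, and 1/t there if t > 1; in the second case \<open>t\<close> lies in the right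
      interval.\<close>
    define d where "d = min (min t (inverse t)) (if t < 1 then 1 - t else 1 - inverse t)"
    have "inverse t < 1" if "\<not> t < 1" using t that by (simp add: inverse_less_1_iff)
    then have "0 < d" using t by (auto simp: d_def)
    then obtain n where n: "inverse (real (Suc n)) < d" using ex_inverse_Suc_less by blast
    have "?e n \<le> inverse (real (Suc n))" by (intro le_imp_inverse_le) auto
    then have ed: "?e n < d" using n by linarith
    have "t \<in> window (?e n)"
    proof (cases "t < 1")
      case True
      then show ?thesis using ed by (auto simp: d_def)
    next
      case False
      then have "?e n < inverse t" "inverse t < 1 - ?e n" using ed by (auto simp: d_def)
      then have "inverse (inverse t) < inverse (?e n)" "inverse (1 - ?e n) < inverse (inverse t)"
        using t e[of n] by (intro less_imp_inverse_less; simp)+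
      then show ?thesis by (simp only: Un_iff greaterThanLessThan_iff inverse_inverse_eq simp_thms)
    qed
    then show "t \<in> (\<Union>n. window (?e n))" by blast
  qed
  moreover have "E (- ({0<..} - {1})) x = 0"
  proof -
    have "E (({0<..} - {1}) \<union> - ({0<..} - {1})) x = E ({0<..} - {1}) x + E (- ({0<..} - {1})) x"
      by (rule E_Un) auto
    then show ?thesis unfolding Compl_partition E_UNIV E_regular by simp
  qed
  ultimately show "E (- (\<Union>n. window (?e n))) x = 0" by simp
qed auto

lemma closure_restrict_D0: "closure (op_restrict (cutting_projection H) D0) = cutting_projection H"
proof
  have "closed (cutting_projection H)"
    using standard by (intro closed_cutting_projection) (simp add: standard_subspace_def)
  then show "closure (op_restrict (cutting_projection H) D0) \<subseteq> cutting_projection H"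
    by (intro closure_minimal) (auto simp: op_restrict_def)
  show "cutting_projection H \<subseteq> closure (op_restrict (cutting_projection H) D0)"
  proof (rule subrelI)
    fix x h assume "(x, h) \<in> cutting_projection H"
    then have h: "h \<in> H" and k: "x - h \<in> symplectic_complement H" by (auto simp: cutting_projection_iff)
    let ?e = "\<lambda>n. inverse (real (Suc (n + 2)))"
    let ?E = "\<lambda>n. E (window (?e n))"
    have e: "0 < ?e n" "?e n < 1/2" for n
      using less_imp_inverse_less[of 2 "real (Suc (n + 2))"] by auto
    have mem: "(?E n x, ?E n h) \<in> op_restrict (cutting_projection H) D0" for n
    proof -
      have W: "window (?e n) \<in> sets borel" by simp
      have "(?E n h, ?E n (J h)) \<in> T" using h by (intro E_Sp W) (auto simp: H_iff)
      then have "?E n h \<in> H" by (simp only: H_iff J_window[OF e])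
      moreover have "?E n x - ?E n h \<in> symplectic_complement H"
      proof -
        \<comment> \<open>Invariance of the complement follows by duality: the projection is moved
          onto \<open>g\<close>, which it keeps in \<open>H\<close>.\<close>
        have "inner (\<i> *\<^sub>C ?E n (x - h)) g = 0" if "g \<in> H" for g
        proof -
          have "(?E n g, ?E n (J g)) \<in> T" using that by (intro E_Sp W) (auto simp: H_iff)
          then have "?E n g \<in> H" by (simp only: H_iff J_window[OF e])
          then have "inner (\<i> *\<^sub>C (x - h)) (?E n g) = 0"
            using k by (simp add: symplectic_complement_def Im_cinner)
          then show ?thesis by (simp only: E_scaleC[OF W, symmetric] E_inner[OF W])
        qed
        then show ?thesis
          unfolding symplectic_complement_def Im_cinner E_diff[OF W, symmetric] by blast
      qed
      moreover have "?E n x \<in> D0" unfolding D0_iff using e[of n] E_idem[OF W] by blast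
      ultimately show ?thesis by (simp add: op_restrict_def cutting_projection_iff)
    qed
    have lim: "(\<lambda>n. (?E n x, ?E n h)) \<longlonglongrightarrow> (x, h)"
      by (intro tendsto_Pair E_window_tendsto)
    show "(x, h) \<in> closure (op_restrict (cutting_projection H) D0)"
      unfolding closure_sequential by (intro exI[of _ "\<lambda>n. (?E n x, ?E n h)"] conjI allI mem lim)
  qed
qed

lemma D0_subset: "D0 \<subseteq> Domain (Sp a_fun) \<inter> Domain (Sp b_fun)"
  using window_Domain unfolding subset_iff D0_iff by blast

lemma is_core_D0: "is_core D0 (cutting_projection H)"
  using subspace_D0 D0_subset Domain_a_b_subset closure_restrict_D0 unfolding is_core_def by blast

text \<open>The restricted graph lies between the restriction to \<open>D0\<close>, already dense in
  the graph, and the closed graph itself.\<close>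

lemma closure_restrict_D:
  "closure (op_restrict (cutting_projection H) (Domain (Sp a_fun) \<inter> Domain (Sp b_fun))) = cutting_projection H"
  (is "closure ?R = _")
proof
  have "closed (cutting_projection H)"
    using standard by (intro closed_cutting_projection) (simp add: standard_subspace_def)
  then show "closure ?R \<subseteq> cutting_projection H"
    by (intro closure_minimal) (auto simp: op_restrict_def)
  have "op_restrict (cutting_projection H) D0 \<subseteq> ?R"
    using D0_subset unfolding op_restrict_def by blast
  then show "cutting_projection H \<subseteq> closure ?R" using closure_mono closure_restrict_D0 by blast
qed

lemma is_core_D: "is_core (Domain (Sp a_fun) \<inter> Domain (Sp b_fun)) (cutting_projection H)"
  unfolding is_core_def
  by (intro conjI subspace_inter subspace_Domain_Sp Domain_a_b_subset closure_restrict_D) auto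

end

theorem theorem2p2:
  fixes H :: "'a::chilbert_space set"
    and \<Delta> :: "'a graph"
    and J :: "'a \<Rightarrow> 'a"
    and E :: "real set \<Rightarrow> 'a \<Rightarrow> 'a"
  assumes "standard_subspace H" and "factorial_subspace H" and "modular_objects H \<Delta> J E"
  defines "P \<equiv> cutting_projection H"
    and "a\<Delta> \<equiv> spectral_integral E a_fun"
    and "b\<Delta> \<equiv> spectral_integral E b_fun"
    and "\<Delta>_half \<equiv> spectral_integral E (\<lambda>t. t powr (1/2))"
    and "\<Delta>_mhalf \<equiv> spectral_integral E (\<lambda>t. t powr (-1/2))"
  defines "D \<equiv> Domain a\<Delta> \<inter> Domain b\<Delta>"
    and "D0 \<equiv> (\<Union>\<epsilon>\<in>{0<..<1/2}. range (E ({\<epsilon><..<1 - \<epsilon>} \<union> {inverse (1 - \<epsilon>)<..<inverse \<epsilon>})))"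
  shows "D \<subseteq> {h + h' | h h'. h \<in> H \<and> h' \<in> symplectic_complement H}
    \<and> op_restrict P D =
        (\<Delta>_mhalf \<odot> (\<Delta>_mhalf \<boxminus> \<Delta>_half)\<inverse>) \<boxplus> (graph_of J \<odot> (\<Delta>_mhalf \<boxminus> \<Delta>_half)\<inverse>)
    \<and> op_restrict P D = a\<Delta> \<boxplus> (graph_of J \<odot> b\<Delta>)
    \<and> is_core D P
    \<and> P = closure (a\<Delta> \<boxplus> (graph_of J \<odot> b\<Delta>))
    \<and> is_core D0 P"
proof -
  interpret modular_theory H \<Delta> J E
    using assms(1-3) by unfold_locales
  show ?thesis
    unfolding P_def a\<Delta>_def b\<Delta>_def \<Delta>_half_def \<Delta>_mhalf_def D_def D0_def
      inverse_minus_half_diff minus_half_comp_b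
    using Domain_a_b_subset op_restrict_cutting is_core_D is_core_D0 closure_restrict_D
    by (simp only: Domain_cutting_projection op_restrict_cutting simp_thms)
qed

end
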